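(* Consider the Bradley-Terry-Luce model on the random bipartite graphs $\mathcal B(n,m,d_{n,m})$, $n\le m$, with merit vectors $\boldsymbol u=\boldsymbol u^{(n,m)}\in\mathbb R^{n+m}$ normalized by $u_1=0$. Let $\alpha_{n,m}=\max_{1\le i,j\le n+m}(u_i-u_j)$ and $$\Delta_{n,m}=\sqrt{\frac{m\log^3(n+m)}{n\,d_{n,m}\,\log^2\!\left(\frac nm d_{n,m}\right)}}.$$ If $$\exp\bigl(2(\alpha_{n,m}+1)\bigr)\,\Delta_{n,m}\to 0\qquad(n,m\to\infty),$$ then the maximum likelihood estimator $\boldsymbol u^*$ (normalized by $u_1^*=0$) is uniformly consistent, i.e. $\|\boldsymbol u^*-\boldsymbol u\|_\infty\to 0$ in probability as $n,m\to\infty$.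
   Context: Random graph: $L=\{1,\dots,n\}$, $R=\{n+1,\dots,n+m\}$, $n\le m$, $1\le d_{n,m}\le m$. A graph $G\sim\mathcal B(n,m,d_{n,m})$ is the bipartite graph on $L\cup R$ obtained by choosing, independently for each $i\in L$, a uniformly random $d_{n,m}$-element subset of $R$ as the set of neighbours of $i$. Model: $\boldsymbol u=(u_1,\dots,u_{n+m})$ is a deterministic real vector (depending on $(n,m)$) and $f(x)=1/(1+\exp(-x))$. Given $G$, independently for each edge $\{i,j\}$ of $G$, subject $i$ beats subject $j$ with probability $f(u_i-u_j)$ and otherwise $j$ beats $i$. Let $A'_{ij}=1$ if $\{i,j\}$ is an edge and $i$ beats $j$, and $A'_{ij}=0$ otherwise. Maximum likelihood estimator: $\boldsymbol u^*$ is the maximizer, over $\boldsymbol v\in\mathbb R^{n+m}$ with $v_1=0$, of $\mathcal L(\boldsymbol v)=\sum_{1\le i\ne j\le n+m}A'_{ij}\log f(v_i-v_j)$ (since $\mathcal L$ is invariant under adding a constant to all coordinates, the normalization $u_1=u_1^*=0$ loses nothing). Limits "$n,m\to\infty$" are taken along a given sequence of pairs $(n,m)$ with $n\le m$ and both tending to infinity. If $\frac nm d_{n,m}=1$ then $\Delta_{n,m}$ is read as $+\infty$. Convergence in probability means: for every $\epsilon>0$, the probability that $\boldsymbol u^*$ exists, is unique, and satisfies $\|\boldsymbol u^*-\boldsymbol u\|_\infty\le\epsilon$ tends to $1$. Probability is over both $G$ and the comparison outcomes. *)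

theory Defs
  imports "HOL-Probability.Probability" "HOL-Probability.Product_PMF"
begin

text \<open>
  Subjects are the numbers in \<open>{1..n+m}\<close>, with left side \<open>{1..n}\<close> and right side \<open>{n+1..n+m}\<close>.
  A bipartite graph is given by its set of edges, each edge \<open>{i, j}\<close> being stored once as the
  pair \<open>(i, j)\<close> with \<open>i\<close> on the left and \<open>j\<close> on the right.
\<close>

definition random_bipartite_graph :: "nat \<Rightarrow> nat \<Rightarrow> nat \<Rightarrow> (nat \<times> nat) set pmf" where
  "random_bipartite_graph n m d =
     map_pmf (\<lambda>S. SIGMA i:{1..n}. S i)
       (Pi_pmf {1..n} {} (\<lambda>_. pmf_of_set {T. T \<subseteq> {n+1..n+m} \<and> card T = d}))"

definition logistic :: "real \<Rightarrow> real" where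
  "logistic x = 1 / (1 + exp (- x))"

text \<open>
  An outcome \<open>W\<close> of the comparisons along \<open>E\<close> has \<open>W (i, j)\<close> true iff the left subject \<open>i\<close>
  beats the right subject \<open>j\<close>; it is \<open>False\<close> by convention off \<open>E\<close>.
\<close>

definition comparison_outcomes ::
    "(nat \<Rightarrow> real) \<Rightarrow> (nat \<times> nat) set \<Rightarrow> (nat \<times> nat \<Rightarrow> bool) pmf" where
  "comparison_outcomes u E =
     Pi_pmf E False (\<lambda>(i, j). bernoulli_pmf (logistic (u i - u j)))"

definition btl_model ::
    "nat \<Rightarrow> nat \<Rightarrow> nat \<Rightarrow> (nat \<Rightarrow> real) \<Rightarrow> ((nat \<times> nat) set \<times> (nat \<times> nat \<Rightarrow> bool)) pmf" where
  "btl_model n m d u =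
     do {
       E \<leftarrow> random_bipartite_graph n m d;
       W \<leftarrow> comparison_outcomes u E;
       return_pmf (E, W)
     }"

text \<open>
  The two disjuncts are the two orientations of a stored edge: \<open>i\<close> is its left end and wins,
  or \<open>i\<close> is its right end and the left end \<open>j\<close> does not win.
\<close>

definition win_matrix ::
    "(nat \<times> nat) set \<times> (nat \<times> nat \<Rightarrow> bool) \<Rightarrow> nat \<Rightarrow> nat \<Rightarrow> real" where
  "win_matrix = (\<lambda>(E, W) i j.
     if ((i, j) \<in> E \<and> W (i, j)) \<or> ((j, i) \<in> E \<and> \<not> W (j, i)) then 1 else 0)"

definition log_likelihood :: "nat \<Rightarrow> (nat \<Rightarrow> nat \<Rightarrow> real) \<Rightarrow> (nat \<Rightarrow> real) \<Rightarrow> real" where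
  "log_likelihood N A v =
     (\<Sum>i\<in>{1..N}. \<Sum>j\<in>{1..N} - {i}. A i j * ln (logistic (v i - v j)))"

text \<open>
  Vectors in \<open>\<real>\<^sup>N\<close> with first coordinate \<open>0\<close>. Extensionality makes equality of such functions
  coincide with equality of their coordinates \<open>1, \<dots>, N\<close>, so that uniqueness of a maximizer
  is meaningful.
\<close>

definition normalized_vectors :: "nat \<Rightarrow> (nat \<Rightarrow> real) set" where
  "normalized_vectors N = {v \<in> extensional {1..N}. v 1 = 0}"

definition is_mle :: "nat \<Rightarrow> (nat \<Rightarrow> nat \<Rightarrow> real) \<Rightarrow> (nat \<Rightarrow> real) \<Rightarrow> bool" where
  "is_mle N A v \<longleftrightarrow> v \<in> normalized_vectors N \<and>
     (\<forall>w\<in>normalized_vectors N. log_likelihood N A w \<le> log_likelihood N A v)"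

definition sup_dist :: "nat \<Rightarrow> (nat \<Rightarrow> real) \<Rightarrow> (nat \<Rightarrow> real) \<Rightarrow> real" where
  "sup_dist N v u = Max ((\<lambda>i. \<bar>v i - u i\<bar>) ` {1..N})"

definition merit_range :: "nat \<Rightarrow> (nat \<Rightarrow> real) \<Rightarrow> real" where
  "merit_range N u = Max ((\<lambda>(i, j). u i - u j) ` ({1..N} \<times> {1..N}))"

text \<open>
  Extended-real valued, because the denominator vanishes when \<open>n d / m = 1\<close>, where the
  quantity is \<open>\<infinity>\<close>.
\<close>

definition Delta :: "nat \<Rightarrow> nat \<Rightarrow> nat \<Rightarrow> ereal" where
  "Delta n m d =
     (if real n / real m * real d = 1 then \<infinity>
      else ereal (sqrt (real m * ln (real (n + m)) ^ 3 /
                   (real n * real d * ln (real n / real m * real d) ^ 2))))"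

end

theory Submission imports Defs begin

text \<open>
  Write \<open>\<lambda> = n d / m\<close> for the mean degree of a right vertex, \<open>N = n + m\<close>, and \<open>w = v - u\<close> for the error of a
  maximizer \<open>v\<close> of the likelihood over the box \<open>|v - u| \<le> r\<close>. Suppose \<open>w\<close> attains both \<open>r\<close> and \<open>-r\<close>.
  Lowering \<open>v\<close> on a top level set \<open>D = {w \<ge> s}\<close> cannot increase the likelihood. In the resulting
  inequality only the edges leaving \<open>D\<close> contribute on one side, and on the other side the noise is at most
  the sum of \<open>sqrt (deg i * ln N)\<close> over \<open>D\<close>. Hence, for a suitable step \<open>t\<close>, almost all edges
  at \<open>D\<close> end in \<open>{w \<ge> s - t}\<close>. The random graph expands: as long as level sets are small, their
  volume grows at each step by a factor of order \<open>\<lambda> / ln N \<ge> sqrt \<lambda>\<close>, so that \<open>O (ln N / ln \<lambda>)\<close>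
  steps lead to a set of linear size and two more to a set containing more than half of the left side. The smallness of
  \<open>\<Delta>\<close> keeps the total descent below \<open>r\<close>, so \<open>w > 0\<close> on more than half of the left side. By reflection
  \<open>w < 0\<close> on more than half of it, a contradiction. Thus, after centering, the maximizer is interior to
  the box, and by concavity it is a global maximizer. The same expansion makes the graph connected, which gives uniqueness.
\<close>

section \<open>Edge counts of the random bipartite graph\<close>

lemma sum_power_card_Pow:
  fixes q :: "'b::comm_semiring_1"
  assumes "finite A"
  shows "(\<Sum>T\<in>Pow A. q ^ card T) = (1 + q) ^ card A"
  using prod_add[OF assms, of "\<lambda>_. q" "\<lambda>_. 1"] by (simp add: add.commute)

text \<open>The ratio of \<open>b choose k\<close> to \<open>m choose k\<close> is a product of
  factors \<open>(b - i) / (m - i)\<close>, each at most \<open>b / m\<close>. Clearing denominators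
  keeps the induction within the natural numbers.\<close>

lemma binomial_mult_power_le:
  fixes b m k :: nat
  assumes "b \<le> m"
  shows "(b choose k) * m ^ k \<le> b ^ k * (m choose k)"
proof (induction k)
  case (Suc k)
  have absorb: "Suc k * (c choose Suc k) = (c - k) * (c choose k)" for c :: nat
    using binomial_absorb_comp[of c k] binomial_absorption[of k c] by simp
  have "(b - k) * m \<le> b * (m - k)"
    using assms by (simp add: diff_mult_distrib diff_mult_distrib2 mult.commute diff_le_mono2)
  then have "(b - k) * m * ((b choose k) * m ^ k) \<le> b * (m - k) * (b ^ k * (m choose k))"
    using Suc.IH by (rule mult_mono) auto
  then have "Suc k * ((b choose Suc k) * m ^ Suc k) \<le> Suc k * (b ^ Suc k * (m choose Suc k))"
    using absorb[of b] absorb[of m]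
    by (metis (no_types, lifting) mult.assoc mult.left_commute power_Suc)
  then show ?case by (simp only: mult_le_cancel1)
qed simp

text \<open>Adjoining \<open>T\<close> is a bijection from the subsets of \<open>R - T\<close> of
  size \<open>d - card T\<close> onto these supersets.\<close>

lemma card_supersets:
  assumes "finite R" "T \<subseteq> R" "card T \<le> d"
  shows "card {S. T \<subseteq> S \<and> S \<subseteq> R \<and> card S = d} = (card R - card T) choose (d - card T)"
proof -
  have fT: "finite T" using assms finite_subset by blast
  have "bij_betw (\<lambda>S. S \<union> T) {S. S \<subseteq> R - T \<and> card S = d - card T}
          {S. T \<subseteq> S \<and> S \<subseteq> R \<and> card S = d}"
  proof (rule bij_betw_byWitness[where f' = "\<lambda>S. S - T"])
    show "(\<lambda>S. S \<union> T) ` {S. S \<subseteq> R - T \<and> card S = d - card T} \<subseteq> {S. T \<subseteq> S \<and> S \<subseteq> R \<and> card S = d}"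
    proof safe
      fix S assume S: "S \<subseteq> R - T" "card S = d - card T"
      have "finite S" using S assms finite_subset by blast
      moreover have "S \<inter> T = {}" using S by auto
      ultimately show "card (S \<union> T) = d"
        using S assms by (simp add: card_Un_disjoint fT)
    qed (use assms in auto)
    show "(\<lambda>S. S - T) ` {S. T \<subseteq> S \<and> S \<subseteq> R \<and> card S = d} \<subseteq> {S. S \<subseteq> R - T \<and> card S = d - card T}"
      using fT by (auto simp: card_Diff_subset)
  qed auto
  then have "card {S. T \<subseteq> S \<and> S \<subseteq> R \<and> card S = d} = card {S. S \<subseteq> R - T \<and> card S = d - card T}"
    by (simp add: bij_betw_same_card)
  also have "\<dots> = (card R - card T) choose (d - card T)"
    using assms fT by (simp add: n_subsets card_Diff_subset)
  finally show ?thesis .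
qed

text \<open>
  Expanding \<open>(1 + z) ^ card (S \<inter> B)\<close> over the subsets \<open>T\<close> of \<open>S \<inter> B\<close> reduces the
  claim to \<open>P (T \<subseteq> S) = (d choose k) / (m choose k)\<close> and \<open>(b choose k) / (m choose k) \<le> (b / m) ^ k\<close>.
\<close>
lemma sum_power_card_Int_le:
  fixes z :: real
  assumes R: "finite R" and B: "B \<subseteq> R" and d: "d \<le> card R" and m: "card R > 0" and z: "z \<ge> 0"
  shows "(\<Sum>S | S \<subseteq> R \<and> card S = d. (1 + z) ^ card (S \<inter> B))
           \<le> (1 + z * card B / card R) ^ d * (card R choose d)"
proof -
  let ?m = "card R" and ?b = "card B"
  define F where "F = {S. S \<subseteq> R \<and> card S = d}"
  have finF: "finite F" using R by (simp add: F_def)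
  have finB: "finite B" using R B finite_subset by blast
  have bm: "?b \<le> ?m" using R B card_mono by blast
  have "(\<Sum>S\<in>F. (1 + z) ^ card (S \<inter> B)) = (\<Sum>S\<in>F. \<Sum>T\<in>Pow B. if T \<subseteq> S then z ^ card T else 0)"
  proof (rule sum.cong[OF refl])
    fix S
    have "(1 + z) ^ card (S \<inter> B) = (\<Sum>T\<in>Pow (S \<inter> B). z ^ card T)"
      using sum_power_card_Pow[of "S \<inter> B" z] finB by simp
    also have "\<dots> = (\<Sum>T\<in>Pow B. if T \<subseteq> S then z ^ card T else 0)"
      using finB by (intro sum.mono_neutral_cong_left) auto
    finally show "(1 + z) ^ card (S \<inter> B) = (\<Sum>T\<in>Pow B. if T \<subseteq> S then z ^ card T else 0)" .
  qed
  also have "\<dots> = (\<Sum>T\<in>Pow B. \<Sum>S\<in>F. if T \<subseteq> S then z ^ card T else 0)"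
    by (rule sum.swap)
  also have "\<dots> = (\<Sum>T\<in>Pow B. z ^ card T * card {S. T \<subseteq> S \<and> S \<subseteq> R \<and> card S = d})"
  proof (rule sum.cong[OF refl])
    fix T
    have "(\<Sum>S\<in>F. if T \<subseteq> S then z ^ card T else 0) = (\<Sum>S\<in>{S\<in>F. T \<subseteq> S}. z ^ card T)"
      by (rule sum.inter_filter[OF finF, symmetric])
    also have "{S\<in>F. T \<subseteq> S} = {S. T \<subseteq> S \<and> S \<subseteq> R \<and> card S = d}" by (auto simp: F_def)
    finally show "(\<Sum>S\<in>F. if T \<subseteq> S then z ^ card T else 0)
        = z ^ card T * card {S. T \<subseteq> S \<and> S \<subseteq> R \<and> card S = d}" by simp
  qed
  also have "\<dots> = (\<Sum>T\<in>Pow B. if card T \<le> d then z ^ card T * ((?m - card T) choose (d - card T)) else 0)"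
  proof (rule sum.cong[OF refl])
    fix T assume T: "T \<in> Pow B"
    show "z ^ card T * card {S. T \<subseteq> S \<and> S \<subseteq> R \<and> card S = d} =
        (if card T \<le> d then z ^ card T * ((?m - card T) choose (d - card T)) else 0)"
    proof (cases "card T \<le> d")
      case True
      then show ?thesis using card_supersets[OF R, of T d] T B by auto
    next
      case False
      have "{S. T \<subseteq> S \<and> S \<subseteq> R \<and> card S = d} = {}"
      proof safe
        fix S assume "T \<subseteq> S" "S \<subseteq> R" "d = card S"
        then show "S \<in> {}" using False R card_mono[of S T] finite_subset by blast
      qed
      then show ?thesis using False by (simp only:) simp
    qed
  qed
  also have "\<dots> = (\<Sum>k\<le>?b. \<Sum>T\<in>{T\<in>Pow B. card T = k}.
       if card T \<le> d then z ^ card T * ((?m - card T) choose (d - card T)) else 0)"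
    using finB by (intro sum.group[symmetric]) (auto intro: card_mono)
  also have "\<dots> = (\<Sum>k\<le>?b. (?b choose k) * (if k \<le> d then z ^ k * ((?m - k) choose (d - k)) else 0))"
  proof (rule sum.cong[OF refl])
    fix k
    have "card {T\<in>Pow B. card T = k} = ?b choose k"
      using n_subsets[OF finB, of k] by simp
    then show "(\<Sum>T\<in>{T\<in>Pow B. card T = k}. if card T \<le> d then z ^ card T * ((?m - card T) choose (d - card T)) else 0)
       = (?b choose k) * (if k \<le> d then z ^ k * ((?m - k) choose (d - k)) else 0)"
      by simp
  qed
  also have "\<dots> \<le> (\<Sum>k\<le>?b. if k \<le> d then (d choose k) * (z * ?b / ?m) ^ k * (?m choose d) else 0)"
  proof (rule sum_mono)
    fix k
    show "(?b choose k) * (if k \<le> d then z ^ k * ((?m - k) choose (d - k)) else 0)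
        \<le> (if k \<le> d then (d choose k) * (z * ?b / ?m) ^ k * (?m choose d) else 0)"
    proof (cases "k \<le> d")
      case True
      have km: "?m choose k > 0" using True d by simp
      have "real ((?b choose k) * ?m ^ k) \<le> real (?b ^ k * (?m choose k))"
        using binomial_mult_power_le[OF bm] of_nat_le_iff by blast
      then have le: "real (?b choose k) \<le> (?b / ?m) ^ k * (?m choose k)"
        using m by (simp add: power_divide field_simps)
      have "(?m choose d) * (d choose k) = (?m choose k) * ((?m - k) choose (d - k))"
        using choose_mult[OF True d] .
      then have eq: "real (?m choose k) * ((?m - k) choose (d - k)) = real (?m choose d) * (d choose k)"
        by (metis of_nat_mult)
      have "(?b choose k) * (z ^ k * ((?m - k) choose (d - k)))
          \<le> (?b / ?m) ^ k * (?m choose k) * (z ^ k * ((?m - k) choose (d - k)))"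
        using le z by (intro mult_right_mono) auto
      also have "\<dots> = (z * ?b / ?m) ^ k * (real (?m choose k) * ((?m - k) choose (d - k)))"
        by (simp add: power_mult_distrib power_divide)
      also have "\<dots> = (d choose k) * (z * ?b / ?m) ^ k * (?m choose d)"
        unfolding eq by simp
      finally show ?thesis using True by simp
    qed simp
  qed
  also have "\<dots> = (\<Sum>k\<in>{..?b} \<inter> {..d}. (d choose k) * (z * ?b / ?m) ^ k * (?m choose d))"
    by (subst sum.inter_restrict) (auto intro!: sum.cong)
  also have "\<dots> \<le> (\<Sum>k\<le>d. (d choose k) * (z * ?b / ?m) ^ k * (?m choose d))"
    using z by (intro sum_mono2) auto
  also have "\<dots> = (1 + z * ?b / ?m) ^ d * (?m choose d)"
    using binomial_ring[of "z * ?b / ?m" 1 d] by (simp add: sum_distrib_right add.commute)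
  finally show ?thesis unfolding F_def .
qed

lemma subsets_of_card:
  assumes "finite R" "d \<le> card R"
  shows "{T. T \<subseteq> R \<and> card T = d} \<noteq> {}" and "finite {T. T \<subseteq> R \<and> card T = d}"
proof -
  obtain T where "T \<subseteq> R" "card T = d"
    using obtain_subset_with_card_n[OF assms(2)] by blast
  then show "{T. T \<subseteq> R \<and> card T = d} \<noteq> {}" by blast
  show "finite {T. T \<subseteq> R \<and> card T = d}"
    using assms(1) by simp
qed

lemma set_Pi_pmf_component:
  assumes "f \<in> set_pmf (Pi_pmf A dflt p)" "finite A" "x \<in> A"
  shows "f x \<in> set_pmf (p x)"
  using assms by (auto simp: set_Pi_pmf PiE_dflt_def)

lemma random_bipartite_graph_support:
  assumes E: "E \<in> set_pmf (random_bipartite_graph n m d)" and d: "d \<le> m"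
  shows "E \<subseteq> {1..n} \<times> {n+1..n+m}"
    and "\<And>A. A \<subseteq> {1..n} \<Longrightarrow> card (E \<inter> A \<times> {n+1..n+m}) = d * card A"
proof -
  let ?F = "{T. T \<subseteq> {n+1..n+m} \<and> card T = d}"
  have ne: "?F \<noteq> {}" "finite ?F"
    using subsets_of_card[of "{n+1..n+m}" d] d by simp_all
  obtain S where S: "S \<in> set_pmf (Pi_pmf {1..n} {} (\<lambda>_. pmf_of_set ?F))" and ES: "E = (SIGMA i:{1..n}. S i)"
    using E unfolding random_bipartite_graph_def set_map_pmf by (rule imageE)
  have SF: "S i \<in> ?F" if "i \<in> {1..n}" for i
    using set_Pi_pmf_component[OF S finite_atLeastAtMost that] unfolding set_pmf_of_set[OF ne] .
  have SR: "S i \<subseteq> {n+1..n+m}" and Sd: "card (S i) = d" if "i \<in> {1..n}" for i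
    using SF[OF that] by simp_all
  show "E \<subseteq> {1..n} \<times> {n+1..n+m}"
    unfolding ES using SR by blast
  show "card (E \<inter> A \<times> {n+1..n+m}) = d * card A" if A: "A \<subseteq> {1..n}" for A
  proof -
    have "E \<inter> A \<times> {n+1..n+m} = (SIGMA i:A. S i)" unfolding ES using SR A by blast
    moreover have "finite A" using A finite_subset by blast
    moreover have "finite (S i)" if "i \<in> A" for i
    proof -
      have "S i \<subseteq> {n+1..n+m}" using SR A that by blast
      then show ?thesis using finite_subset by blast
    qed
    ultimately have "card (E \<inter> A \<times> {n+1..n+m}) = (\<Sum>i\<in>A. card (S i))" by simp
    also have "\<dots> = (\<Sum>i\<in>A. d)" using Sd A by (intro sum.cong) auto
    finally show ?thesis by simp
  qed
qed

lemma finite_set_random_bipartite_graph: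
  assumes "d \<le> m"
  shows "finite (set_pmf (random_bipartite_graph n m d))"
proof (rule finite_subset)
  show "set_pmf (random_bipartite_graph n m d) \<subseteq> Pow ({1..n} \<times> {n+1..n+m})"
    using random_bipartite_graph_support(1)[OF _ assms] by blast
qed simp

text \<open>The neighbourhoods of distinct left vertices are independent, so the expectation factors
  over \<open>A\<close>. Each factor is a hypergeometric generating function, dominated by the
  binomial one at \<open>z = exp 1 - 1\<close>.\<close>

lemma expectation_exp_edges_le:
  assumes d: "d \<le> m" and m: "m > 0" and A: "A \<subseteq> {1..n}" and B: "B \<subseteq> {n+1..n+m}"
  shows "measure_pmf.expectation (random_bipartite_graph n m d) (\<lambda>E. exp (real (card (E \<inter> A \<times> B))))
           \<le> (1 + (exp 1 - 1) * card B / m) ^ (d * card A)"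
proof -
  let ?R = "{n+1..n+m}"
  let ?F = "{T. T \<subseteq> ?R \<and> card T = d}"
  have F: "?F \<noteq> {}" "finite ?F"
    using subsets_of_card[of ?R d] d by simp_all
  have finB: "finite B" using B finite_subset by blast
  have cardF: "card ?F = m choose d" by (simp add: n_subsets)
  \<comment> \<open>Vertices outside \<open>A\<close> get the factor 1, so that the product runs
    over the whole index set of \<open>Pi_pmf\<close>.\<close>
  define g :: "nat \<Rightarrow> nat set \<Rightarrow> real" where
    "g = (\<lambda>i T. if i \<in> A then exp (real (card (T \<inter> B))) else 1)"
  have single: "measure_pmf.expectation (pmf_of_set ?F) (\<lambda>T. exp (real (card (T \<inter> B))))
                  \<le> (1 + (exp 1 - 1) * card B / m) ^ d"
  proof -
    have "exp (real k) = (1 + (exp 1 - 1)) ^ k" for k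
      using exp_of_nat_mult[of k "1::real"] by simp
    then have "(\<Sum>T\<in>?F. exp (real (card (T \<inter> B)))) = (\<Sum>T\<in>?F. (1 + (exp 1 - 1)) ^ card (T \<inter> B))"
      by (simp only:)
    also have "\<dots> \<le> (1 + (exp 1 - 1) * card B / m) ^ d * (m choose d)"
      using sum_power_card_Int_le[of ?R B d "exp 1 - 1"] B d m by simp
    finally have "(\<Sum>T\<in>?F. exp (real (card (T \<inter> B)))) \<le> (1 + (exp 1 - 1) * card B / m) ^ d * (m choose d)" .
    then show ?thesis
      unfolding integral_pmf_of_set[OF F] cardF using d by (simp only: divide_le_eq) simp
  qed
  have card_eq: "card ((SIGMA i:{1..n}. S i) \<inter> A \<times> B) = (\<Sum>i\<in>A. card (S i \<inter> B))" for S
  proof -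
    have "(SIGMA i:{1..n}. S i) \<inter> A \<times> B = (SIGMA i:A. S i \<inter> B)" using A by auto
    then show ?thesis using finB A finite_subset[OF A] by simp
  qed
  have "measure_pmf.expectation (random_bipartite_graph n m d) (\<lambda>E. exp (real (card (E \<inter> A \<times> B))))
      = measure_pmf.expectation (Pi_pmf {1..n} {} (\<lambda>_. pmf_of_set ?F)) (\<lambda>S. \<Prod>i\<in>{1..n}. g i (S i))"
  proof -
    have "exp (real (card ((SIGMA i:{1..n}. S i) \<inter> A \<times> B))) = (\<Prod>i\<in>{1..n}. g i (S i))" for S
    proof -
      have "exp (real (card ((SIGMA i:{1..n}. S i) \<inter> A \<times> B))) = (\<Prod>i\<in>A. exp (real (card (S i \<inter> B))))"
        unfolding card_eq using finite_subset[OF A] by (simp add: exp_sum)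
      also have "\<dots> = (\<Prod>i\<in>{1..n}. g i (S i))"
        unfolding g_def using A by (intro prod.mono_neutral_cong_left) auto
      finally show ?thesis .
    qed
    then show ?thesis unfolding random_bipartite_graph_def by simp
  qed
  also have "\<dots> = (\<Prod>i\<in>{1..n}. measure_pmf.expectation (pmf_of_set ?F) (g i))"
  proof (rule expectation_prod_Pi_pmf)
    show "integrable (pmf_of_set ?F) (g i)" for i
      using set_pmf_of_set[OF F] F(2) by (intro integrable_measure_pmf_finite) (simp only:)
  qed (auto simp: g_def)
  also have "\<dots> = (\<Prod>i\<in>A. measure_pmf.expectation (pmf_of_set ?F) (\<lambda>T. exp (real (card (T \<inter> B)))))"
    using A by (intro prod.mono_neutral_cong_right) (auto simp: g_def)
  also have "\<dots> \<le> (\<Prod>i\<in>A. (1 + (exp 1 - 1) * card B / m) ^ d)"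
    using single by (intro prod_mono) (auto intro!: integral_nonneg_AE)
  also have "\<dots> = (1 + (exp 1 - 1) * card B / m) ^ (d * card A)"
    by (simp add: power_mult)
  finally show ?thesis .
qed

section \<open>Exponential tail bounds for edge counts\<close>

text \<open>Chernoff's method with the parameter fixed at 1: Markov's inequality for the exponential
  of the edge count.\<close>

lemma prob_edges_ge:
  assumes d: "d \<le> m" and m: "m > 0" and A: "A \<subseteq> {1..n}" and B: "B \<subseteq> {n+1..n+m}"
  shows "measure_pmf.prob (random_bipartite_graph n m d) {E. x \<le> real (card (E \<inter> A \<times> B))}
           \<le> exp (- x) * (1 + (exp 1 - 1) * card B / m) ^ (d * card A)"
proof -
  let ?P = "random_bipartite_graph n m d"
  have "measure_pmf.prob ?P {E. x \<le> real (card (E \<inter> A \<times> B))}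
      = measure ?P {E\<in>space ?P. exp x \<le> exp (real (card (E \<inter> A \<times> B)))}"
    by simp
  also have "\<dots> \<le> measure_pmf.expectation ?P (\<lambda>E. exp (real (card (E \<inter> A \<times> B)))) / exp x"
    by (rule integral_Markov_inequality_measure[where A = "{}"])
       (auto intro!: integrable_measure_pmf_finite finite_set_random_bipartite_graph d)
  also have "\<dots> \<le> (1 + (exp 1 - 1) * card B / m) ^ (d * card A) / exp x"
    using expectation_exp_edges_le[OF assms] by (intro divide_right_mono) auto
  finally show ?thesis by (simp add: exp_minus divide_inverse mult.commute)
qed

text \<open>Follows from \<open>exp 1 - 1 \<le> 2\<close> and \<open>1 + y \<le> exp y\<close>. The
  positive term of the exponent is twice the expected edge count.\<close>

corollary prob_edges_ge_exp:
  assumes d: "d \<le> m" and m: "m > 0" and A: "A \<subseteq> {1..n}" and B: "B \<subseteq> {n+1..n+m}"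
  shows "measure_pmf.prob (random_bipartite_graph n m d) {E. x \<le> real (card (E \<inter> A \<times> B))}
           \<le> exp (2 * d * card A * card B / m - x)"
proof -
  have "1 + (exp 1 - 1) * card B / m \<le> 1 + 2 * real (card B) / m"
    using exp_le by (intro add_left_mono divide_right_mono mult_right_mono) auto
  also have "\<dots> \<le> exp (2 * real (card B) / m)"
    by (rule exp_ge_add_one_self)
  finally have "(1 + (exp 1 - 1) * card B / m) ^ (d * card A) \<le> exp (2 * real (card B) / m) ^ (d * card A)"
    by (intro power_mono) (auto intro!: add_nonneg_nonneg divide_nonneg_nonneg mult_nonneg_nonneg)
  also have "\<dots> = exp (2 * d * card A * card B / m)"
    using exp_of_nat_mult[of "d * card A" "2 * real (card B) / m"] by (simp add: mult_ac)
  finally have "exp (- x) * (1 + (exp 1 - 1) * card B / m) ^ (d * card A)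
      \<le> exp (- x) * exp (2 * d * card A * card B / m)"
    by (intro mult_left_mono) auto
  also have "\<dots> = exp (2 * d * card A * card B / m - x)"
    by (simp only: exp_add[symmetric]) simp
  finally show ?thesis
    using prob_edges_ge[OF assms, of x] by linarith
qed

text \<open>Every left vertex has exactly \<open>d\<close> neighbours, so few edges to \<open>B\<close> means many edges to its complement.\<close>
lemma prob_edges_le:
  assumes d: "d \<le> m" and m: "m > 0" and A: "A \<subseteq> {1..n}" and B: "B \<subseteq> {n+1..n+m}"
  shows "measure_pmf.prob (random_bipartite_graph n m d) {E. real (card (E \<inter> A \<times> B)) \<le> x}
           \<le> exp (x - d * card A * card B / (2 * m))"
proof -
  let ?P = "random_bipartite_graph n m d" and ?R = "{n+1..n+m}"
  let ?\<beta> = "card B / m"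
  have finB: "finite B" using B finite_subset by blast
  have bm: "card B \<le> m" using card_mono[OF _ B] by simp
  \<comment> \<open>The degree identity that trades edges into \<open>B\<close> for edges into its
    complement is available only on the support.\<close>
  have "measure_pmf.prob ?P {E. real (card (E \<inter> A \<times> B)) \<le> x}
      = measure_pmf.prob ?P ({E. real (card (E \<inter> A \<times> B)) \<le> x} \<inter> set_pmf ?P)"
    by (simp add: measure_Int_set_pmf)
  also have "\<dots> \<le> measure_pmf.prob ?P {E. d * card A - x \<le> real (card (E \<inter> A \<times> (?R - B)))}"
  proof (rule measure_pmf.finite_measure_mono)
    show "{E. real (card (E \<inter> A \<times> B)) \<le> x} \<inter> set_pmf ?P
          \<subseteq> {E. d * card A - x \<le> real (card (E \<inter> A \<times> (?R - B)))}"
    proof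
      fix E assume E: "E \<in> {E. real (card (E \<inter> A \<times> B)) \<le> x} \<inter> set_pmf ?P"
      then have "finite E"
        using random_bipartite_graph_support(1)[of E n m d] d finite_subset[of E "{1..n} \<times> ?R"] by auto
      then have "card (E \<inter> A \<times> B \<union> E \<inter> A \<times> (?R - B)) = card (E \<inter> A \<times> B) + card (E \<inter> A \<times> (?R - B))"
        by (intro card_Un_disjoint) auto
      moreover have "E \<inter> A \<times> B \<union> E \<inter> A \<times> (?R - B) = E \<inter> A \<times> ?R" using B by auto
      ultimately have "card (E \<inter> A \<times> B) + card (E \<inter> A \<times> (?R - B)) = d * card A"
        using random_bipartite_graph_support(2)[of E n m d A] A d E by simp
      then have "real (card (E \<inter> A \<times> B)) + real (card (E \<inter> A \<times> (?R - B))) = d * card A"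
        by (metis of_nat_add)
      then show "E \<in> {E. d * card A - x \<le> real (card (E \<inter> A \<times> (?R - B)))}" using E by auto
    qed
  qed simp
  also have "\<dots> \<le> exp (x - d * card A) * (1 + (exp 1 - 1) * card (?R - B) / m) ^ (d * card A)"
    using prob_edges_ge[OF d m A, of "?R - B" "d * card A - x"] by auto
  also have "1 + (exp 1 - 1) * card (?R - B) / m = exp 1 - (exp 1 - 1) * ?\<beta>"
  proof -
    have "real (card (?R - B)) = real m - real (card B)"
      using bm B finB by (simp only: card_Diff_subset of_nat_diff) simp
    then show ?thesis using m by (simp only:) (simp add: diff_divide_distrib right_diff_distrib)
  qed
  \<comment> \<open>From \<open>exp 1 \<ge> 2\<close> follows
    \<open>exp 1 - 1 \<ge> exp 1 / 2\<close>. So the base is at most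
    \<open>exp 1 * (1 - ?\<beta> / 2)\<close>, to which \<open>1 - y \<le> exp (- y)\<close>
    applies.\<close>
  also have "(exp 1 - (exp 1 - 1) * ?\<beta>) ^ (d * card A) \<le> (exp 1 * exp (- ?\<beta> / 2)) ^ (d * card A)"
  proof (rule power_mono)
    have e2: "exp 1 \<ge> (2::real)" using exp_ge_add_one_self[of "1::real"] by simp
    have "exp 1 * (1 + - ?\<beta> / 2) \<le> exp 1 * exp (- ?\<beta> / 2)"
      by (intro mult_left_mono exp_ge_add_one_self) auto
    moreover have "exp 1 - (exp 1 - 1) * ?\<beta> \<le> exp 1 * (1 + - ?\<beta> / 2)"
    proof -
      have "(exp 1 / 2) * ?\<beta> \<le> (exp 1 - 1) * ?\<beta>" using e2 by (intro mult_right_mono) auto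
      then show ?thesis by (simp add: algebra_simps)
    qed
    ultimately show "exp 1 - (exp 1 - 1) * ?\<beta> \<le> exp 1 * exp (- ?\<beta> / 2)" by linarith
    have "(exp 1 - 1) * ?\<beta> \<le> (exp 1 - 1) * 1"
      using e2 bm m by (intro mult_left_mono) auto
    then show "0 \<le> exp 1 - (exp 1 - 1) * ?\<beta>" by simp
  qed
  also have "exp (x - d * card A) * (exp 1 * exp (- ?\<beta> / 2)) ^ (d * card A)
      = exp (x - d * card A * card B / (2 * m))"
  proof -
    have "(exp 1 * exp (- ?\<beta> / 2)) ^ (d * card A) = exp (real (d * card A) * (1 - ?\<beta> / 2))"
      unfolding exp_of_nat_mult exp_add[symmetric] by simp
    then have "exp (x - d * card A) * (exp 1 * exp (- ?\<beta> / 2)) ^ (d * card A)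
        = exp (x - d * card A + real (d * card A) * (1 - ?\<beta> / 2))"
      by (simp only: exp_add)
    also have "x - d * card A + real (d * card A) * (1 - ?\<beta> / 2) = x - d * card A * card B / (2 * m)"
      by (simp add: algebra_simps)
    finally show ?thesis .
  qed
  finally show ?thesis by simp
qed

section \<open>Bipartite expanders\<close>

text \<open>The deterministic properties of a typical random graph that the argument uses.
  \<open>small_right\<close>: a right set of at most a 64th of \<open>R\<close> receives at most a
  sixteenth of the edges at \<open>A\<close>, up to \<open>C\<close> edges per vertex.
  \<open>small_left\<close> is the mirror image, with the mean right degree in place of
  \<open>d\<close>. \<open>large\<close>: sets holding a 64th of their sides are joined by a fixed
  proportion of all edges. For the random graph, \<open>C\<close> is
  \<open>2 * ln (n + m)\<close>.\<close>

locale bipartite_expander =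
  fixes L R :: "'a set" and E :: "('a \<times> 'a) set" and d :: nat and C :: real
  assumes finite_L: "finite L" and finite_R: "finite R" and disjoint: "L \<inter> R = {}"
    and L_nonempty: "L \<noteq> {}" and card_le: "card L \<le> card R"
    and d_pos: "d > 0" and C_pos: "C > 0"
    and edges_sub: "E \<subseteq> L \<times> R"
    and left_degree: "\<And>A. A \<subseteq> L \<Longrightarrow> card (E \<inter> A \<times> R) = d * card A"
    and right_degree: "\<And>j. j \<in> R \<Longrightarrow> real (card L) * d / (4 * card R) \<le> card (E \<inter> L \<times> {j})"
    and small_right: "\<And>A B. \<lbrakk>A \<subseteq> L; B \<subseteq> R; 64 * card B \<le> card R\<rbrakk>
          \<Longrightarrow> card (E \<inter> A \<times> B) \<le> real d * card A / 16 + C * card B"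
    and small_left: "\<And>A B. \<lbrakk>A \<subseteq> L; B \<subseteq> R; 64 * card A \<le> card L\<rbrakk>
          \<Longrightarrow> card (E \<inter> A \<times> B) \<le> real (card L) * d / card R * card B / 16 + C * card A"
    and large: "\<And>A B. \<lbrakk>A \<subseteq> L; B \<subseteq> R; card L \<le> 64 * card A; card R \<le> 64 * card B\<rbrakk>
          \<Longrightarrow> real (card L) * d / 2 ^ 14 < card (E \<inter> A \<times> B)"
begin

text \<open>The sum of the degrees over \<open>D\<close>, so an edge inside \<open>D\<close> counts
  twice.\<close>

definition volume :: "'a set \<Rightarrow> nat" where
  "volume D = card (E \<inter> (D \<inter> L) \<times> R) + card (E \<inter> L \<times> (D \<inter> R))"

definition leaving :: "'a set \<Rightarrow> 'a set \<Rightarrow> nat" where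
  "leaving D D' = card (E \<inter> (D \<inter> L) \<times> (R - D')) + card (E \<inter> (L - D') \<times> (D \<inter> R))"

text \<open>Expansion leads from one side to the other, so growth is tracked on the heavier side
  alone. \<open>bulk\<close> agrees with \<open>volume\<close> up to a factor 2 and never exceeds
  the number of edges.\<close>

definition bulk :: "'a set \<Rightarrow> nat" where
  "bulk D = max (card (E \<inter> (D \<inter> L) \<times> R)) (card (E \<inter> L \<times> (D \<inter> R)))"

text \<open>As long as this fails, \<open>small_right\<close> and \<open>small_left\<close> both
  apply; once it holds, \<open>large\<close> takes over.\<close>

definition large_set :: "'a set \<Rightarrow> bool" where
  "large_set D \<longleftrightarrow> card L < 64 * card (D \<inter> L) \<or> card R < 64 * card (D \<inter> R)"

definition mean_degree :: real where
  "mean_degree = real (card L) * d / card R"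

lemma finite_E: "finite E"
  using edges_sub finite_L finite_R finite_subset by blast

lemma card_L_pos: "card L > 0" and card_R_pos: "card R > 0"
proof -
  show "card L > 0" using L_nonempty finite_L by (simp add: card_gt_0_iff)
  then show "card R > 0" using card_le by linarith
qed

lemma mean_degree_pos: "mean_degree > 0"
  using card_L_pos card_R_pos d_pos by (simp add: mean_degree_def)

lemma mean_degree_le: "mean_degree \<le> d"
  using card_le card_R_pos by (simp add: mean_degree_def divide_le_eq mult.commute mult_left_mono)

lemma edges_split_right:
  "card (E \<inter> A \<times> B) + card (E \<inter> A \<times> (R - B)) = card (E \<inter> A \<times> R)" if "B \<subseteq> R"
proof -
  have "card (E \<inter> A \<times> B \<union> E \<inter> A \<times> (R - B)) = card (E \<inter> A \<times> B) + card (E \<inter> A \<times> (R - B))"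
    using finite_E by (intro card_Un_disjoint) auto
  moreover have "E \<inter> A \<times> B \<union> E \<inter> A \<times> (R - B) = E \<inter> A \<times> R" using that by auto
  ultimately show ?thesis by simp
qed

lemma edges_split_left:
  "card (E \<inter> A \<times> B) + card (E \<inter> (L - A) \<times> B) = card (E \<inter> L \<times> B)" if "A \<subseteq> L"
proof -
  have "card (E \<inter> A \<times> B \<union> E \<inter> (L - A) \<times> B) = card (E \<inter> A \<times> B) + card (E \<inter> (L - A) \<times> B)"
    using finite_E by (intro card_Un_disjoint) auto
  moreover have "E \<inter> A \<times> B \<union> E \<inter> (L - A) \<times> B = E \<inter> L \<times> B" using that by auto
  ultimately show ?thesis by simp
qed

lemma right_volume_ge: "mean_degree / 4 * card B \<le> card (E \<inter> L \<times> B)" if "B \<subseteq> R"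
proof -
  have finB: "finite B" using that finite_R finite_subset by blast
  have "card (E \<inter> L \<times> B) = card (\<Union>j\<in>B. E \<inter> L \<times> {j})"
    by (rule arg_cong[of _ _ card]) auto
  also have "\<dots> = (\<Sum>j\<in>B. card (E \<inter> L \<times> {j}))"
    using finB finite_E by (intro card_UN_disjoint) auto
  finally have eq: "real (card (E \<inter> L \<times> B)) = (\<Sum>j\<in>B. real (card (E \<inter> L \<times> {j})))"
    by simp
  have "(\<Sum>j\<in>B. mean_degree / 4) \<le> (\<Sum>j\<in>B. real (card (E \<inter> L \<times> {j})))"
    using right_degree that by (intro sum_mono) (auto simp: mean_degree_def mult.commute)
  then show ?thesis using eq by (simp add: mult.commute)
qed

lemma edges_mono: "A \<subseteq> A' \<Longrightarrow> B \<subseteq> B' \<Longrightarrow> card (E \<inter> A \<times> B) \<le> card (E \<inter> A' \<times> B')"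
  using finite_E by (intro card_mono) auto

lemma bulk_le: "bulk D \<le> d * card L"
  using edges_mono[of "D \<inter> L" L R R] edges_mono[of L L "D \<inter> R" R] left_degree[of L]
  by (simp add: bulk_def)

lemma volume_le_bulk: "volume D \<le> 2 * bulk D"
  by (simp add: volume_def bulk_def)

lemma bulk_pos:
  assumes "D \<noteq> {}" "D \<subseteq> L \<union> R"
  shows "bulk D \<ge> 1"
proof (cases "D \<inter> L = {}")
  case False
  then have "card (D \<inter> L) > 0" using finite_L by (simp add: card_gt_0_iff)
  then have "card (E \<inter> (D \<inter> L) \<times> R) > 0" using left_degree[of "D \<inter> L"] d_pos by simp
  then show ?thesis by (simp add: bulk_def)
next
  case True
  then have "card (D \<inter> R) > 0" using finite_R assms by (auto simp: card_gt_0_iff)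
  then have "mean_degree / 4 * card (D \<inter> R) > 0" using mean_degree_pos by simp
  then have "real (card (E \<inter> L \<times> (D \<inter> R))) > 0" using right_volume_ge[of "D \<inter> R", OF Int_lower2] by linarith
  then show ?thesis by (simp add: bulk_def)
qed

text \<open>The heavier side of \<open>D\<close> carries at least half of the volume, so at least
  half of its edges end in \<open>D'\<close>. Since \<open>D'\<close> is small, the small-set bounds
  allow this only if \<open>D'\<close> has at least \<open>bulk D / (4 * C)\<close> vertices on the
  opposite side, each of degree at least \<open>mean_degree / 4\<close>.\<close>

lemma bulk_grows:
  assumes out: "leaving D D' \<le> volume D / 4" and small: "\<not> large_set D'"
  shows "mean_degree / (16 * C) * bulk D \<le> bulk D'"
proof (cases "card (E \<inter> L \<times> (D \<inter> R)) \<le> card (E \<inter> (D \<inter> L) \<times> R)")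
  case True
  let ?v = "real (card (E \<inter> (D \<inter> L) \<times> R))" and ?b = "card (D' \<inter> R)"
  have v: "?v = d * card (D \<inter> L)" "bulk D = ?v"
    using left_degree[of "D \<inter> L"] True by (simp_all add: bulk_def)
  have "real (card (E \<inter> (D \<inter> L) \<times> (R - D'))) \<le> ?v / 2"
    using out True by (simp add: leaving_def volume_def)
  moreover have "real (card (E \<inter> (D \<inter> L) \<times> (D' \<inter> R))) + card (E \<inter> (D \<inter> L) \<times> (R - D')) = ?v"
    using edges_split_right[of "D' \<inter> R" "D \<inter> L"] by (simp add: Diff_Int_distrib Diff_Int flip: of_nat_add)
  ultimately have "?v / 2 \<le> card (E \<inter> (D \<inter> L) \<times> (D' \<inter> R))" by linarith
  also have "\<dots> \<le> ?v / 16 + C * ?b"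
    using small_right[of "D \<inter> L" "D' \<inter> R"] small v by (simp add: large_set_def)
  finally have "?v \<le> 4 * C * ?b" by linarith
  then have "mean_degree / (16 * C) * ?v \<le> mean_degree / (16 * C) * (4 * C * ?b)"
    using mean_degree_pos C_pos by (intro mult_left_mono) auto
  also have "\<dots> = mean_degree / 4 * ?b"
    using C_pos by (simp add: field_simps)
  also have "\<dots> \<le> card (E \<inter> L \<times> (D' \<inter> R))" by (rule right_volume_ge) simp
  also have "\<dots> \<le> bulk D'" by (simp add: bulk_def)
  finally show ?thesis using v(2) by simp
next
  case False
  let ?v = "real (card (E \<inter> L \<times> (D \<inter> R)))" and ?a = "card (D' \<inter> L)"
  have v: "mean_degree / 4 * card (D \<inter> R) \<le> ?v" "bulk D = ?v"
    using right_volume_ge[of "D \<inter> R"] False by (simp_all add: bulk_def)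
  have "real (card (E \<inter> (L - D') \<times> (D \<inter> R))) \<le> ?v / 2"
    using out False by (simp add: leaving_def volume_def)
  moreover have "real (card (E \<inter> (D' \<inter> L) \<times> (D \<inter> R))) + card (E \<inter> (L - D') \<times> (D \<inter> R)) = ?v"
    using edges_split_left[of "D' \<inter> L" "D \<inter> R"] by (simp add: Diff_Int_distrib Diff_Int flip: of_nat_add)
  ultimately have "?v / 2 \<le> card (E \<inter> (D' \<inter> L) \<times> (D \<inter> R))" by linarith
  also have "\<dots> \<le> mean_degree * card (D \<inter> R) / 16 + C * ?a"
    using small_left[of "D' \<inter> L" "D \<inter> R"] small by (simp add: large_set_def mean_degree_def)
  also have "\<dots> \<le> ?v / 4 + C * ?a" using v(1) by simp
  finally have "?v \<le> 4 * C * ?a" by linarith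
  then have "mean_degree / (16 * C) * ?v \<le> mean_degree / (16 * C) * (4 * C * ?a)"
    using mean_degree_pos C_pos by (intro mult_left_mono) auto
  also have "\<dots> = mean_degree / 4 * ?a"
    using C_pos by (simp add: field_simps)
  also have "\<dots> \<le> d * ?a"
    using mean_degree_le mean_degree_pos mult_right_mono[of "mean_degree / 4" d "real ?a"] by simp
  also have "\<dots> = card (E \<inter> (D' \<inter> L) \<times> R)" using left_degree[of "D' \<inter> L"] by simp
  also have "\<dots> \<le> bulk D'" by (simp add: bulk_def)
  finally show ?thesis using v(2) by simp
qed

text \<open>The volume is at most twice the number of edges; the resulting threshold is the one in
  \<open>large\<close>.\<close>

lemma leaving_le:
  assumes "leaving D D' \<le> volume D / 2 ^ 15"
  shows "leaving D D' \<le> real (card L) * d / 2 ^ 14"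
proof -
  have "volume D \<le> 2 * (d * card L)" using volume_le_bulk[of D] bulk_le[of D] by linarith
  then have "real (volume D) \<le> 2 * (real d * card L)" by (metis of_nat_le_iff of_nat_mult of_nat_numeral)
  then show ?thesis using assms by (simp add: mult.commute)
qed

text \<open>If \<open>D'\<close> missed a 64th of the left side, \<open>large\<close> would give
  more edges between the missed vertices and \<open>D\<close> than leave at all. So
  \<open>D'\<close> misses less than that.\<close>

lemma spread_left:
  assumes out: "leaving D D' \<le> volume D / 2 ^ 15" and B: "card R < 64 * card (D \<inter> R)"
  shows "card L < 2 * card (D' \<inter> L)"
proof -
  have "\<not> card L \<le> 64 * card (L - D')"
  proof
    assume "card L \<le> 64 * card (L - D')"
    then have "real (card L) * d / 2 ^ 14 < card (E \<inter> (L - D') \<times> (D \<inter> R))"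
      using B by (intro large) auto
    then show False using leaving_le[OF out] by (simp add: leaving_def)
  qed
  moreover have "card (D' \<inter> L) + card (L - D') = card L"
    using card_Int_Diff[OF finite_L, of D'] by (simp add: Int_commute)
  ultimately show ?thesis by linarith
qed

lemma spread_right:
  assumes out: "leaving D D' \<le> volume D / 2 ^ 15" and A: "card L < 64 * card (D \<inter> L)"
  shows "card R < 64 * card (D' \<inter> R)"
proof -
  have "\<not> card R \<le> 64 * card (R - D')"
  proof
    assume "card R \<le> 64 * card (R - D')"
    then have "real (card L) * d / 2 ^ 14 < card (E \<inter> (D \<inter> L) \<times> (R - D'))"
      using A by (intro large) auto
    then show False using leaving_le[OF out] by (simp add: leaving_def)
  qed
  moreover have "card (D' \<inter> R) + card (R - D') = card R"
    using card_Int_Diff[OF finite_R, of D'] by (simp add: Int_commute)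
  ultimately show ?thesis by linarith
qed

text \<open>While the sets are not large, \<open>bulk\<close> gains the factor
  \<open>mean_degree / (16 * C)\<close> at each step. After \<open>K\<close> steps it would exceed
  the number of edges, so some set up to index \<open>K\<close> is large. Two spreading steps then
  reach more than half of the left side.\<close>

lemma chain_covers_half:
  fixes D :: "nat \<Rightarrow> 'a set"
  assumes D0: "D 0 \<noteq> {}" and D_sub: "D 0 \<subseteq> L \<union> R" and D_mono: "\<And>k. D k \<subseteq> D (Suc k)"
    and out: "\<And>k. k < K + 2 \<Longrightarrow> leaving (D k) (D (Suc k)) \<le> volume (D k) / 2 ^ 15"
    and K: "real (card L) * d < (mean_degree / (16 * C)) ^ K"
  shows "card L < 2 * card (D (K + 2) \<inter> L)"
proof -
  let ?g = "mean_degree / (16 * C)"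
  have g: "?g > 0" using mean_degree_pos C_pos by simp
  have mono: "D i \<subseteq> D j" if "i \<le> j" for i j
    using lift_Suc_mono_le[of D, OF D_mono that] .
  have "\<exists>k\<le>K. large_set (D k)"
  proof (rule ccontr)
    assume "\<not> (\<exists>k\<le>K. large_set (D k))"
    then have small: "\<not> large_set (D k)" if "k \<le> K" for k using that by blast
    have "?g ^ k \<le> bulk (D k)" if "k \<le> K" for k
      using that
    proof (induction k)
      case 0
      then show ?case using bulk_pos[OF D0 D_sub] by simp
    next
      case (Suc k)
      have "leaving (D k) (D (Suc k)) \<le> volume (D k) / 4"
        using out[of k] Suc.prems by (simp add: order_trans)
      then have "?g * bulk (D k) \<le> bulk (D (Suc k))"
        using Suc.prems small by (intro bulk_grows) auto
      moreover have "?g * ?g ^ k \<le> ?g * bulk (D k)"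
        using Suc g by (intro mult_left_mono) auto
      ultimately show ?case by simp
    qed
    then have "?g ^ K \<le> bulk (D K)" by simp
    also have "real (bulk (D K)) \<le> real (card L) * d"
      using bulk_le[of "D K"] by (metis mult.commute of_nat_le_iff of_nat_mult)
    finally show False using K by simp
  qed
  then obtain k where k: "k \<le> K" "large_set (D k)" by blast
  \<comment> \<open>A large right part is carried to index \<open>K + 1\<close> by monotonicity and
    takes one more step; a large left part is carried to index \<open>K\<close> and takes two, by
    way of the right side.\<close>
  show ?thesis
  proof (cases "card R < 64 * card (D k \<inter> R)")
    case True
    have "card (D k \<inter> R) \<le> card (D (K + 1) \<inter> R)"
      using mono[of k "K + 1"] k finite_R by (intro card_mono) auto
    then show ?thesis using spread_left[OF out[of "K + 1"]] True by simp
  next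
    case False
    have "card (D k \<inter> L) \<le> card (D K \<inter> L)"
      using mono[of k K] k finite_L by (intro card_mono) auto
    then have "card L < 64 * card (D K \<inter> L)"
      using k False by (simp add: large_set_def)
    then have "card R < 64 * card (D (Suc K) \<inter> R)"
      using spread_right[OF out[of K]] by simp
    then show ?thesis using spread_left[OF out[of "K + 1"]] by simp
  qed
qed

end

section \<open>Union bounds: the random graph is an expander\<close>

text \<open>The sum of \<open>q ^ (card A + card B)\<close> over all pairs factors by the binomial
  theorem. The pair of empty sets would contribute 1; its event is empty, so this 1 can be
  subtracted.\<close>

lemma prob_Union_pairs_le:
  fixes p :: "'c pmf" and q :: real
  assumes fin: "finite L" "finite R" and q: "q \<ge> 0"
    and bound: "\<And>A B. A \<subseteq> L \<Longrightarrow> B \<subseteq> R \<Longrightarrow> measure_pmf.prob p (Bad A B) \<le> q ^ (card A + card B)"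
    and empty: "Bad {} {} = {}"
  shows "measure_pmf.prob p (\<Union>A\<in>Pow L. \<Union>B\<in>Pow R. Bad A B) \<le> (1 + q) ^ (card L + card R) - 1"
proof -
  let ?I = "Pow L \<times> Pow R"
  have fI: "finite ?I" using fin by simp
  have "measure_pmf.prob p (\<Union>A\<in>Pow L. \<Union>B\<in>Pow R. Bad A B)
      = measure_pmf.prob p (\<Union>(A, B)\<in>?I - {({}, {})}. Bad A B)"
    using empty by (intro arg_cong[of _ _ "measure_pmf.prob p"]) auto
  also have "\<dots> \<le> (\<Sum>(A, B)\<in>?I - {({}, {})}. measure_pmf.prob p (Bad A B))"
    using fI measure_UNION_le[of "?I - {({}, {})}" "\<lambda>(A, B). Bad A B" p]
    by (simp add: case_prod_unfold)
  also have "\<dots> \<le> (\<Sum>(A, B)\<in>?I - {({}, {})}. q ^ (card A + card B))"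
    using bound by (intro sum_mono) auto
  also have "\<dots> = (\<Sum>(A, B)\<in>?I. q ^ (card A + card B)) - 1"
    using fI by (subst sum_diff1) auto
  also have "(\<Sum>(A, B)\<in>?I. q ^ (card A + card B)) = (\<Sum>A\<in>Pow L. q ^ card A) * (\<Sum>B\<in>Pow R. q ^ card B)"
    by (simp add: sum_product sum.cartesian_product power_add)
  also have "\<dots> = (1 + q) ^ (card L + card R)"
    using fin by (simp add: sum_power_card_Pow power_add)
  finally show ?thesis .
qed

lemma one_plus_inverse_square_power_le:
  assumes "N \<ge> (1::nat)"
  shows "(1 + 1 / real N ^ 2) ^ N - 1 \<le> 2 / N"
proof -
  have "(1 + 1 / real N ^ 2) ^ N \<le> exp (1 / real N ^ 2) ^ N"
    by (intro power_mono exp_ge_add_one_self) auto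
  also have "\<dots> = exp (1 / N)"
    using assms exp_of_nat_mult[of N "1 / real N ^ 2"] by (simp add: power2_eq_square)
  also have "\<dots> \<le> 1 + 1 / N + (1 / N)\<^sup>2"
    using assms by (intro exp_bound) auto
  also have "(1 / real N)\<^sup>2 \<le> 1 / N"
    using assms power_decreasing[of 1 2 "1 / real N"] by simp
  finally show ?thesis by simp
qed

text \<open>There are four failure events: low right degrees, the two small-set conditions and the
  large-set condition. Their probabilities are at most 1, 2, 2 and 1 times
  \<open>1 / (n + m)\<close>.\<close>

lemma prob_not_expander_le:
  fixes n m d :: nat
  defines "l \<equiv> ln (real (n + m))" and "\<rho> \<equiv> real n * d / m"
  assumes n: "n \<ge> 1" and nm: "n \<le> m" and d1: "d \<ge> 1" and dm: "d \<le> m"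
    and l64: "64 * l \<le> \<rho>" and big: "2 ^ 16 \<le> \<rho>"
  shows "measure_pmf.prob (random_bipartite_graph n m d)
           {E. \<not> bipartite_expander {1..n} {n+1..n+m} E d (2 * l)} \<le> 6 / (n + m)"
proof -
  let ?P = "random_bipartite_graph n m d"
  let ?L = "{1..n}" and ?R = "{n+1..n+m}" and ?N = "n + m"
  have m: "m > 0" using n nm by simp
  have N: "?N \<ge> 2" using n nm by simp
  have l_pos: "l > 0" using N by (simp add: l_def)
  have l_ge: "exp (- l) = 1 / ?N" using N by (simp add: l_def exp_minus inverse_eq_divide)
  have \<rho>_eq: "\<rho> * m = n * d" using m by (simp add: \<rho>_def)
  have \<rho>_le_d: "\<rho> \<le> d" using nm m by (simp add: \<rho>_def divide_le_eq mult.commute mult_left_mono)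
  \<comment> \<open>Every vertex of \<open>A\<close> and \<open>B\<close> has to cost a factor
    \<open>q\<close>. With this choice the sum over all pairs is still of order
    \<open>1 / ?N\<close>.\<close>
  define q where "q = 1 / real ?N ^ 2"
  have q_eq: "q = exp (- 2 * l)"
    using exp_of_nat_mult[of 2 "- l"] l_ge by (simp add: q_def power_divide)
  have q_pow: "exp y \<le> q ^ k" if "y \<le> - 2 * l * k" for y k
  proof -
    have "exp y \<le> exp (k * (- 2 * l))" using that by (simp add: mult.commute)
    also have "\<dots> = q ^ k" unfolding q_eq by (rule exp_of_nat_mult)
    finally show ?thesis .
  qed

  define bad_degree where "bad_degree = (\<Union>j\<in>?R. {E. real (card (E \<inter> ?L \<times> {j})) \<le> \<rho> / 4})"
  define bad_right where "bad_right = (\<Union>A\<in>Pow ?L. \<Union>B\<in>Pow ?R.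
     {E. 64 * card B \<le> m \<and> real d * card A / 16 + 2 * l * card B < card (E \<inter> A \<times> B)})"
  define bad_left where "bad_left = (\<Union>A\<in>Pow ?L. \<Union>B\<in>Pow ?R.
     {E. 64 * card A \<le> n \<and> \<rho> * card B / 16 + 2 * l * card A < card (E \<inter> A \<times> B)})"
  define bad_large where "bad_large = (\<Union>(A, B)\<in>Pow ?L \<times> Pow ?R.
     {E. n \<le> 64 * card A \<and> m \<le> 64 * card B \<and> card (E \<inter> A \<times> B) \<le> real n * d / 2 ^ 14})"

  have "measure_pmf.prob ?P bad_degree \<le> (\<Sum>j\<in>?R. measure_pmf.prob ?P {E. real (card (E \<inter> ?L \<times> {j})) \<le> \<rho> / 4})"
    unfolding bad_degree_def by (rule measure_UNION_le) auto
  also have "\<dots> \<le> (\<Sum>j\<in>?R. exp (- 2 * l))"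
  proof (rule sum_mono)
    fix j assume "j \<in> ?R"
    then have "measure_pmf.prob ?P {E. real (card (E \<inter> ?L \<times> {j})) \<le> \<rho> / 4} \<le> exp (\<rho> / 4 - d * n / (2 * m))"
      using prob_edges_le[OF dm m, of ?L n "{j}" "\<rho> / 4"] by simp
    also have "\<rho> / 4 - d * n / (2 * m) = - \<rho> / 4"
      using m by (simp add: \<rho>_def field_simps)
    also have "exp (- \<rho> / 4) \<le> exp (- 2 * l)" using l64 l_pos by simp
    finally show "measure_pmf.prob ?P {E. real (card (E \<inter> ?L \<times> {j})) \<le> \<rho> / 4} \<le> exp (- 2 * l)" .
  qed
  also have "\<dots> \<le> ?N * q" unfolding q_eq by simp
  also have "\<dots> = 1 / ?N" by (simp add: q_def power2_eq_square)
  finally have degree: "measure_pmf.prob ?P bad_degree \<le> 1 / ?N" .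

  have "measure_pmf.prob ?P bad_right \<le> (1 + q) ^ (card ?L + card ?R) - 1"
    unfolding bad_right_def
  proof (rule prob_Union_pairs_le)
    fix A B assume A: "A \<subseteq> ?L" and B: "B \<subseteq> ?R"
    show "measure_pmf.prob ?P {E. 64 * card B \<le> m \<and> real d * card A / 16 + 2 * l * card B < card (E \<inter> A \<times> B)}
          \<le> q ^ (card A + card B)"
    proof (cases "64 * card B \<le> m")
      case True
      let ?x = "real d * card A / 16 + 2 * l * card B"
      have "measure_pmf.prob ?P {E. 64 * card B \<le> m \<and> ?x < card (E \<inter> A \<times> B)}
          \<le> measure_pmf.prob ?P {E. ?x \<le> card (E \<inter> A \<times> B)}"
        by (rule measure_pmf.finite_measure_mono) auto
      also have "\<dots> \<le> exp (2 * d * card A * card B / m - ?x)"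
        by (rule prob_edges_ge_exp[OF dm m A B])
      also have "\<dots> \<le> q ^ (card A + card B)"
      proof (rule q_pow)
        \<comment> \<open>The positive term \<open>2 * d * card A * card B / m\<close> uses up at
          most half of \<open>d * card A / 16\<close>. The other half is at least
          \<open>2 * l * card A\<close> because \<open>64 * l \<le> \<rho> \<le> d\<close>.\<close>
        have "real (card B) / m \<le> 1 / 64" using True m by (simp add: divide_le_eq)
        then have "2 * real d * card A * (real (card B) / m) \<le> 2 * real d * card A * (1 / 64)"
          by (intro mult_left_mono) auto
        then have "2 * real d * card A * card B / m \<le> real d * card A / 32" by simp
        moreover have "64 * l * card A \<le> d * real (card A)"
          using l64 \<rho>_le_d by (intro mult_right_mono) auto
        moreover have "real (2 * d * card A * card B) / m = 2 * real d * card A * card B / m"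
            "- 2 * l * real (card A + card B) = - 2 * (l * card A) - 2 * (l * card B)"
          by (simp_all add: algebra_simps)
        ultimately show "2 * d * card A * card B / m - ?x \<le> - 2 * l * (card A + card B)"
          by (simp only:)
      qed
      finally show ?thesis .
    qed (simp add: q_def)
  qed (auto simp: q_def)
  then have right: "measure_pmf.prob ?P bad_right \<le> 2 / ?N"
    using one_plus_inverse_square_power_le[of ?N] N by (simp add: q_def)

  have "measure_pmf.prob ?P bad_left \<le> (1 + q) ^ (card ?L + card ?R) - 1"
    unfolding bad_left_def
  proof (rule prob_Union_pairs_le)
    fix A B assume A: "A \<subseteq> ?L" and B: "B \<subseteq> ?R"
    show "measure_pmf.prob ?P {E. 64 * card A \<le> n \<and> \<rho> * card B / 16 + 2 * l * card A < card (E \<inter> A \<times> B)}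
          \<le> q ^ (card A + card B)"
    proof (cases "64 * card A \<le> n")
      case True
      let ?x = "\<rho> * card B / 16 + 2 * l * card A"
      have "measure_pmf.prob ?P {E. 64 * card A \<le> n \<and> ?x < card (E \<inter> A \<times> B)}
          \<le> measure_pmf.prob ?P {E. ?x \<le> card (E \<inter> A \<times> B)}"
        by (rule measure_pmf.finite_measure_mono) auto
      also have "\<dots> \<le> exp (2 * d * card A * card B / m - ?x)"
        by (rule prob_edges_ge_exp[OF dm m A B])
      also have "\<dots> \<le> q ^ (card A + card B)"
      proof (rule q_pow)
        \<comment> \<open>The mirror image: the positive term uses up at most half of
          \<open>\<rho> * card B / 16\<close>, and the other half pays for the vertices of
          \<open>B\<close>.\<close>
        have "2 * real d * card A * card B / m = 2 * (card A / n) * (\<rho> * card B)"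
          using n m by (simp add: \<rho>_def field_simps)
        also have "\<dots> \<le> 2 * (1 / 64) * (\<rho> * card B)"
          using True n by (intro mult_right_mono mult_left_mono) (auto simp: divide_le_eq \<rho>_def)
        finally have "2 * real d * card A * card B / m \<le> \<rho> * card B / 32" by simp
        moreover have "64 * l * card B \<le> \<rho> * real (card B)"
          using l64 by (intro mult_right_mono) auto
        moreover have "real (2 * d * card A * card B) / m = 2 * real d * card A * card B / m"
            "- 2 * l * real (card A + card B) = - 2 * (l * card A) - 2 * (l * card B)"
          by (simp_all add: algebra_simps)
        ultimately show "2 * d * card A * card B / m - ?x \<le> - 2 * l * (card A + card B)"
          by (simp only:)
      qed
      finally show ?thesis .
    qed (simp add: q_def)
  qed (auto simp: q_def)
  then have left: "measure_pmf.prob ?P bad_left \<le> 2 / ?N"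
    using one_plus_inverse_square_power_le[of ?N] N by (simp add: q_def)

  have "measure_pmf.prob ?P bad_large \<le> (\<Sum>(A, B)\<in>Pow ?L \<times> Pow ?R. measure_pmf.prob ?P
      {E. n \<le> 64 * card A \<and> m \<le> 64 * card B \<and> card (E \<inter> A \<times> B) \<le> real n * d / 2 ^ 14})"
    unfolding bad_large_def case_prod_unfold by (rule measure_UNION_le) auto
  also have "\<dots> \<le> (\<Sum>(A, B)\<in>Pow ?L \<times> Pow ?R. exp (- 2 * real ?N))"
  proof (rule sum_mono, clarsimp simp only: mem_Sigma_iff Pow_iff)
    fix A B assume A: "A \<subseteq> ?L" and B: "B \<subseteq> ?R"
    let ?x = "real n * d / 2 ^ 14"
    show "measure_pmf.prob ?P {E. n \<le> 64 * card A \<and> m \<le> 64 * card B \<and> card (E \<inter> A \<times> B) \<le> ?x}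
        \<le> exp (- 2 * real ?N)"
    proof (cases "n \<le> 64 * card A \<and> m \<le> 64 * card B")
      case True
      have "measure_pmf.prob ?P {E. n \<le> 64 * card A \<and> m \<le> 64 * card B \<and> card (E \<inter> A \<times> B) \<le> ?x}
          \<le> measure_pmf.prob ?P {E. card (E \<inter> A \<times> B) \<le> ?x}"
        by (rule measure_pmf.finite_measure_mono) auto
      also have "\<dots> \<le> exp (?x - d * card A * card B / (2 * real m))"
        by (rule prob_edges_le[OF dm m A B])
      also have "\<dots> \<le> exp (- 2 * real ?N)"
      proof -
        \<comment> \<open>The Chernoff exponent is at least \<open>n * d / 2 ^ 13\<close>, twice the
          threshold \<open>?x\<close>. What remains is at least \<open>4 * m \<ge> 2 * ?N\<close>,
          since \<open>n * d \<ge> 2 ^ 16 * m\<close>; this beats the \<open>2 ^ ?N\<close>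
          pairs.\<close>
        have "(real n / 64) * (real m / 64) \<le> card A * card B"
          unfolding of_nat_mult using True by (intro mult_mono) auto
        then have "(real n * m / 4096) * (d / (2 * m)) \<le> (card A * card B) * (d / (2 * m))"
          by (intro mult_right_mono) auto
        then have "real n * d / 2 ^ 13 \<le> d * card A * card B / (2 * m)"
          using m by (simp add: mult_ac)
        moreover have "2 ^ 16 * real m \<le> real n * d"
          using mult_right_mono[OF big, of "real m"] \<rho>_eq by simp
        moreover have "real ?N \<le> 2 * m" using nm by simp
        ultimately show ?thesis by simp
      qed
      finally show ?thesis .
    next
      case False
      then have "{E. n \<le> 64 * card A \<and> m \<le> 64 * card B \<and> card (E \<inter> A \<times> B) \<le> ?x} = {}" by blast
      then show ?thesis by (simp only: measure_empty) simp
    qed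
  qed
  also have "\<dots> = 2 ^ ?N * exp (- 2 * real ?N)"
    by (simp add: card_cartesian_product card_Pow power_add)
  also have "\<dots> \<le> exp (real ?N) * exp (- 2 * real ?N)"
  proof -
    have "(2::real) ^ ?N \<le> exp 1 ^ ?N"
      using exp_ge_add_one_self[of "1::real"] by (intro power_mono) auto
    then show ?thesis using exp_of_nat_mult[of ?N "1::real"] by (intro mult_right_mono) auto
  qed
  also have "\<dots> = exp (- real ?N)" by (simp only: exp_add[symmetric]) simp
  also have "\<dots> \<le> 1 / ?N"
  proof -
    have "real ?N \<le> exp (real ?N)" using exp_ge_add_one_self[of "real ?N"] by linarith
    then have "inverse (exp (real ?N)) \<le> inverse (real ?N)"
      using N by (intro le_imp_inverse_le) auto
    then show ?thesis by (simp only: exp_minus inverse_eq_divide)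
  qed
  finally have large: "measure_pmf.prob ?P bad_large \<le> 1 / ?N" .

  have "measure_pmf.prob ?P {E. \<not> bipartite_expander ?L ?R E d (2 * l)}
      = measure_pmf.prob ?P ({E. \<not> bipartite_expander ?L ?R E d (2 * l)} \<inter> set_pmf ?P)"
    by (simp add: measure_Int_set_pmf)
  also have "\<dots> \<le> measure_pmf.prob ?P (bad_degree \<union> bad_right \<union> bad_left \<union> bad_large)"
  proof (rule measure_pmf.finite_measure_mono)
    show "{E. \<not> bipartite_expander ?L ?R E d (2 * l)} \<inter> set_pmf ?P
        \<subseteq> bad_degree \<union> bad_right \<union> bad_left \<union> bad_large"
    proof (rule subsetI, rule ccontr)
      fix E
      assume E: "E \<in> {E. \<not> bipartite_expander ?L ?R E d (2 * l)} \<inter> set_pmf ?P"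
        and good: "E \<notin> bad_degree \<union> bad_right \<union> bad_left \<union> bad_large"
      have "bipartite_expander ?L ?R E d (2 * l)"
      proof
        show "real (card ?L) * d / (4 * card ?R) \<le> card (E \<inter> ?L \<times> {j})" if "j \<in> ?R" for j
          using good that unfolding bad_degree_def by (force simp: \<rho>_def)
        show "card (E \<inter> A \<times> B) \<le> real d * card A / 16 + 2 * l * card B"
          if "A \<subseteq> ?L" "B \<subseteq> ?R" "64 * card B \<le> card ?R" for A B
          using good that unfolding bad_right_def by (force simp: not_less)
        show "card (E \<inter> A \<times> B) \<le> real (card ?L) * d / card ?R * card B / 16 + 2 * l * card A"
          if "A \<subseteq> ?L" "B \<subseteq> ?R" "64 * card A \<le> card ?L" for A B
          using good that unfolding bad_left_def by (force simp: not_less \<rho>_def)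
        show "real (card ?L) * d / 2 ^ 14 < card (E \<inter> A \<times> B)"
          if "A \<subseteq> ?L" "B \<subseteq> ?R" "card ?L \<le> 64 * card A" "card ?R \<le> 64 * card B" for A B
          using good that unfolding bad_large_def by (force simp: not_le)
      qed (use n nm d1 l_pos random_bipartite_graph_support[of E n m d] dm E in auto)
      then show False using E by simp
    qed
  qed simp
  also have "\<dots> \<le> measure_pmf.prob ?P bad_degree + measure_pmf.prob ?P bad_right
      + measure_pmf.prob ?P bad_left + measure_pmf.prob ?P bad_large"
    by (intro order_trans[OF measure_Un_le] add_mono order_refl) auto
  also have "\<dots> \<le> 1 / ?N + 2 / ?N + 2 / ?N + 1 / ?N"
    by (intro add_mono degree right left large)
  finally show ?thesis by simp
qed

section \<open>Noise of the comparisons\<close>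

lemma logistic_bounds: "0 < logistic x" "logistic x < 1"
  by (simp_all add: logistic_def add_pos_pos)

text \<open>At the true merits this is the centred noise of a comparison. At any other vector it is
  the score of the edge, the derivative of its log-likelihood in the merit difference.\<close>

definition residual :: "('a \<Rightarrow> real) \<Rightarrow> ('a \<times> 'a \<Rightarrow> bool) \<Rightarrow> 'a \<times> 'a \<Rightarrow> real" where
  "residual u W e = of_bool (W e) - logistic (u (fst e) - u (snd e))"

lemma prob_residual_sum_ge:
  assumes fin: "finite E" and F: "F \<subseteq> E" "F \<noteq> {}" and x: "x \<ge> 0"
  shows "measure_pmf.prob (comparison_outcomes u E) {W. x \<le> \<bar>\<Sum>e\<in>F. residual u W e\<bar>}
           \<le> 2 * exp (- 2 * x\<^sup>2 / card F)"
proof -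
  let ?M = "comparison_outcomes u E"
  let ?p = "\<lambda>e. logistic (u (fst e) - u (snd e))"
  have M: "?M = Pi_pmf E False (\<lambda>e. bernoulli_pmf (?p e))"
    by (simp add: comparison_outcomes_def case_prod_unfold)
  have finF: "finite F" using fin F finite_subset by blast
  have p: "0 \<le> ?p e" "?p e \<le> 1" for e
    using logistic_bounds less_imp_le by blast+
  have expect: "measure_pmf.expectation ?M (\<lambda>W. of_bool (W e)) = ?p e" if "e \<in> F" for e
  proof -
    have "measure_pmf.expectation ?M (\<lambda>W. of_bool (W e) :: real)
        = measure_pmf.expectation (map_pmf (\<lambda>W. W e) ?M) of_bool"
      by simp
    also have "map_pmf (\<lambda>W. W e) ?M = bernoulli_pmf (?p e)"
      unfolding M using that F fin by (subst Pi_pmf_component) auto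
    also have "measure_pmf.expectation (bernoulli_pmf (?p e)) of_bool = ?p e"
      using p[of e] by simp
    finally show ?thesis .
  qed
  have indep: "prob_space.indep_vars ?M (\<lambda>_. count_space UNIV) (\<lambda>e W. W e) F"
    unfolding M
    by (rule prob_space.indep_vars_subset[OF measure_pmf.prob_space_axioms indep_vars_Pi_pmf[OF fin] F(1)])
  interpret Hoeffding_ineq ?M F "\<lambda>e W. of_bool (W e)" "\<lambda>_. 0" "\<lambda>_. 1" "\<Sum>e\<in>F. ?p e"
  proof unfold_locales
    show "prob_space.indep_vars ?M (\<lambda>_. borel) (\<lambda>e W. of_bool (W e) :: real) F"
      by (rule prob_space.indep_vars_compose2[OF measure_pmf.prob_space_axioms indep]) auto
    show "(\<Sum>e\<in>F. ?p e) \<equiv> (\<Sum>e\<in>F. measure_pmf.expectation ?M (\<lambda>W. of_bool (W e)))"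
      using expect by simp
  qed (auto simp: finF)
  have "(\<Sum>e\<in>F. of_bool (W e)) - (\<Sum>e\<in>F. ?p e) = (\<Sum>e\<in>F. residual u W e)" for W
    by (simp add: residual_def sum_subtractf)
  moreover have "(0::real) < card F" using finF F by (simp add: card_gt_0_iff)
  ultimately show ?thesis using Hoeffding_ineq_abs_ge[OF x] by simp
qed

text \<open>Conditioning on the first stage: inside \<open>B\<close> the conditional probability is
  bounded by 1, outside by \<open>c\<close>.\<close>

lemma prob_bind_pmf_le:
  assumes "\<And>x. x \<in> set_pmf p \<Longrightarrow> x \<notin> B \<Longrightarrow> measure_pmf.prob (f x) A \<le> c" and c: "c \<ge> 0"
  shows "measure_pmf.prob (bind_pmf p f) A \<le> measure_pmf.prob p B + c"
proof -
  have "emeasure (bind_pmf p f) A = (\<integral>\<^sup>+x. emeasure (f x) A \<partial>p)" by simp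
  also have "\<dots> \<le> (\<integral>\<^sup>+x. indicator B x + ennreal c \<partial>p)"
  proof (rule nn_integral_mono_AE, rule AE_pmfI)
    fix x assume x: "x \<in> set_pmf p"
    show "emeasure (f x) A \<le> indicator B x + ennreal c"
    proof (cases "x \<in> B")
      case True
      have "emeasure (f x) A \<le> 1" by (rule measure_pmf.emeasure_le_1)
      then show ?thesis using True by (simp add: add_increasing2)
    next
      case False
      then show ?thesis using assms(1)[OF x False] by (simp add: measure_pmf.emeasure_eq_measure ennreal_leI)
    qed
  qed
  also have "\<dots> = emeasure p B + ennreal c"
    by (subst nn_integral_add) auto
  also have "\<dots> = ennreal (measure_pmf.prob p B + c)"
    using c by (simp add: measure_pmf.emeasure_eq_measure)
  finally have "ennreal (measure_pmf.prob (bind_pmf p f) A) \<le> ennreal (measure_pmf.prob p B + c)"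
    by (simp only: measure_pmf.emeasure_eq_measure)
  then show ?thesis
    using c by (subst (asm) ennreal_le_iff) auto
qed

text \<open>The noise at each vertex is measured relative to its degree, so that summation over a
  vertex set gives a bound by its volume.\<close>

definition small_noise ::
    "'a set \<Rightarrow> 'a set \<Rightarrow> real \<Rightarrow> ('a \<Rightarrow> real) \<Rightarrow> ('a \<times> 'a) set \<Rightarrow> ('a \<times> 'a \<Rightarrow> bool) \<Rightarrow> bool" where
  "small_noise L R \<kappa> u E W \<longleftrightarrow>
     (\<forall>i\<in>L. \<bar>\<Sum>e\<in>E \<inter> {i} \<times> R. residual u W e\<bar> \<le> \<kappa> * card (E \<inter> {i} \<times> R)) \<and>
     (\<forall>j\<in>R. \<bar>\<Sum>e\<in>E \<inter> L \<times> {j}. residual u W e\<bar> \<le> \<kappa> * card (E \<inter> L \<times> {j}))"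

text \<open>All degrees are at least \<open>\<rho> / 4\<close>, so the level
  \<open>sqrt (4 * l / \<rho>)\<close> makes the Hoeffding exponent at least \<open>2 * l\<close> at
  each vertex. The union over \<open>n + m\<close> vertices costs one factor
  \<open>n + m\<close>.\<close>

lemma prob_not_small_noise_le:
  fixes n m d :: nat
  defines "l \<equiv> ln (real (n + m))" and "\<rho> \<equiv> real n * d / m"
  assumes exp: "bipartite_expander {1..n} {n+1..n+m} E d C"
  shows "measure_pmf.prob (comparison_outcomes u E) {W. \<not> small_noise {1..n} {n+1..n+m} (sqrt (4 * l / \<rho>)) u E W}
           \<le> 2 / (n + m)"
proof -
  interpret bipartite_expander "{1..n}" "{n+1..n+m}" E d C by (rule exp)
  let ?M = "comparison_outcomes u E" and ?N = "n + m"
  define \<kappa> where "\<kappa> = sqrt (4 * l / \<rho>)"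
  \<comment> \<open>The edges at the vertex \<open>v\<close>, on whichever side it lies.\<close>
  define F where "F v = (if v \<le> n then E \<inter> {v} \<times> {n+1..n+m} else E \<inter> {1..n} \<times> {v})" for v
  have n: "n > 0" and m: "m > 0" using card_L_pos card_R_pos by simp_all
  have \<rho>: "\<rho> = mean_degree" unfolding \<rho>_def mean_degree_def by simp
  have \<rho>_pos: "\<rho> > 0" using mean_degree_pos \<rho> by simp
  have l: "l \<ge> 0" using n by (simp add: l_def)
  have \<kappa>: "\<kappa> \<ge> 0" "\<kappa>\<^sup>2 = 4 * l / \<rho>" using \<rho>_pos l by (simp_all add: \<kappa>_def)
  have card_F: "\<rho> / 4 \<le> card (F v)" if "v \<in> {1..?N}" for v
  proof (cases "v \<le> n")
    case True
    then have "card (F v) = d" using left_degree[of "{v}"] that by (simp add: F_def)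
    then show ?thesis using mean_degree_le \<rho>_pos \<rho> by simp
  next
    case False
    then show ?thesis using right_degree[of v] that by (simp add: F_def \<rho>_def mult.commute)
  qed
  have "measure_pmf.prob ?M {W. \<not> small_noise {1..n} {n+1..n+m} \<kappa> u E W}
      \<le> measure_pmf.prob ?M (\<Union>v\<in>{1..?N}. {W. \<kappa> * card (F v) \<le> \<bar>\<Sum>e\<in>F v. residual u W e\<bar>})"
  proof (rule measure_pmf.finite_measure_mono)
    show "{W. \<not> small_noise {1..n} {n+1..n+m} \<kappa> u E W} \<subseteq> (\<Union>v\<in>{1..?N}. {W. \<kappa> * card (F v) \<le> \<bar>\<Sum>e\<in>F v. residual u W e\<bar>})"
    proof (rule subsetI, rule ccontr)
      fix W assume W: "W \<in> {W. \<not> small_noise {1..n} {n+1..n+m} \<kappa> u E W}"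
        and "W \<notin> (\<Union>v\<in>{1..?N}. {W. \<kappa> * card (F v) \<le> \<bar>\<Sum>e\<in>F v. residual u W e\<bar>})"
      then have less: "\<bar>\<Sum>e\<in>F v. residual u W e\<bar> \<le> \<kappa> * card (F v)" if "v \<in> {1..?N}" for v
        using that by force
      have "small_noise {1..n} {n+1..n+m} \<kappa> u E W"
        unfolding small_noise_def
      proof (intro conjI ballI)
        fix i assume "i \<in> {1..n}"
        then show "\<bar>\<Sum>e\<in>E \<inter> {i} \<times> {n+1..n+m}. residual u W e\<bar> \<le> \<kappa> * card (E \<inter> {i} \<times> {n+1..n+m})"
          using less[of i] by (simp add: F_def)
      next
        fix j assume "j \<in> {n+1..n+m}"
        then show "\<bar>\<Sum>e\<in>E \<inter> {1..n} \<times> {j}. residual u W e\<bar> \<le> \<kappa> * card (E \<inter> {1..n} \<times> {j})"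
          using less[of j] by (simp add: F_def)
      qed
      then show False using W by simp
    qed
  qed simp
  also have "\<dots> \<le> (\<Sum>v\<in>{1..?N}. measure_pmf.prob ?M {W. \<kappa> * card (F v) \<le> \<bar>\<Sum>e\<in>F v. residual u W e\<bar>})"
    by (rule measure_UNION_le) auto
  also have "\<dots> \<le> (\<Sum>v\<in>{1..?N}. 2 * (1 / real ?N ^ 2))"
  proof (rule sum_mono)
    fix v assume v: "v \<in> {1..?N}"
    have pos: "card (F v) > 0" using card_F[OF v] \<rho>_pos by (simp add: Suc_le_eq flip: of_nat_0_less_iff)
    then have "F v \<noteq> {}" by auto
    then have "measure_pmf.prob ?M {W. \<kappa> * card (F v) \<le> \<bar>\<Sum>e\<in>F v. residual u W e\<bar>}
        \<le> 2 * exp (- 2 * (\<kappa> * card (F v))\<^sup>2 / card (F v))"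
      using \<kappa>(1) finite_E by (intro prob_residual_sum_ge) (auto simp: F_def)
    also have "- 2 * (\<kappa> * card (F v))\<^sup>2 / card (F v) = - 2 * (4 * l / \<rho>) * card (F v)"
    proof -
      have "- 2 * (\<kappa> * card (F v))\<^sup>2 / card (F v) = - 2 * \<kappa>\<^sup>2 * card (F v)"
        using pos by (simp add: power2_eq_square)
      then show ?thesis unfolding \<kappa>(2) .
    qed
    also have "\<dots> \<le> - 2 * l"
    proof -
      have "4 * l / \<rho> * (\<rho> / 4) \<le> 4 * l / \<rho> * card (F v)"
        using card_F[OF v] l \<rho>_pos by (intro mult_left_mono) auto
      then show ?thesis using \<rho>_pos by simp
    qed
    also have "exp (- 2 * l) = 1 / real ?N ^ 2"
      using n exp_of_nat_mult[of 2 l] by (simp add: l_def exp_minus inverse_eq_divide)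
    finally show "measure_pmf.prob ?M {W. \<kappa> * card (F v) \<le> \<bar>\<Sum>e\<in>F v. residual u W e\<bar>}
        \<le> 2 * (1 / real ?N ^ 2)" by simp
  qed
  also have "\<dots> = 2 / ?N" by (simp add: power2_eq_square del: of_nat_add)
  finally show ?thesis by (simp add: \<kappa>_def)
qed

text \<open>The graph fails with probability at most \<open>6 / (n + m)\<close>; given a good graph,
  the outcomes fail with probability at most \<open>2 / (n + m)\<close>.\<close>

lemma prob_btl_model_bad_le:
  fixes n m d :: nat
  defines "l \<equiv> ln (real (n + m))" and "\<rho> \<equiv> real n * d / m"
  assumes "n \<ge> 1" "n \<le> m" "d \<ge> 1" "d \<le> m" "64 * l \<le> \<rho>" "2 ^ 16 \<le> \<rho>"
  shows "measure_pmf.prob (btl_model n m d u)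
           {(E, W). \<not> (bipartite_expander {1..n} {n+1..n+m} E d (2 * l) \<and> small_noise {1..n} {n+1..n+m} (sqrt (4 * l / \<rho>)) u E W)}
           \<le> 8 / (n + m)"
proof -
  let ?bad = "{(E, W). \<not> (bipartite_expander {1..n} {n+1..n+m} E d (2 * l) \<and> small_noise {1..n} {n+1..n+m} (sqrt (4 * l / \<rho>)) u E W)}"
  let ?B = "{E. \<not> bipartite_expander {1..n} {n+1..n+m} E d (2 * l)}"
  have "measure_pmf.prob (btl_model n m d u) ?bad \<le> measure_pmf.prob (random_bipartite_graph n m d) ?B + 2 / (n + m)"
    unfolding btl_model_def
  proof (rule prob_bind_pmf_le)
    fix E assume "E \<notin> ?B"
    then have E: "bipartite_expander {1..n} {n+1..n+m} E d (2 * l)" by simp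
    have "measure_pmf.prob (comparison_outcomes u E \<bind> (\<lambda>W. return_pmf (E, W))) ?bad
        = measure_pmf.prob (comparison_outcomes u E) (Pair E -` ?bad)"
      by (simp flip: map_pmf_def)
    also have "Pair E -` ?bad = {W. \<not> small_noise {1..n} {n+1..n+m} (sqrt (4 * l / \<rho>)) u E W}"
      using E by auto
    finally show "measure_pmf.prob (comparison_outcomes u E \<bind> (\<lambda>W. return_pmf (E, W))) ?bad \<le> 2 / (n + m)"
      using prob_not_small_noise_le[OF E, of u] by (simp add: l_def \<rho>_def)
  qed simp
  also have "measure_pmf.prob (random_bipartite_graph n m d) ?B \<le> 6 / (n + m)"
    using assms unfolding l_def \<rho>_def by (intro prob_not_expander_le)
  finally show ?thesis by simp
qed

section \<open>The likelihood as a function of merit differences\<close>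

lemma logistic_minus: "logistic (- x) = 1 - logistic x"
proof -
  have "1 + exp x \<noteq> 0" "1 + exp (- x) \<noteq> 0" using exp_gt_zero[of x] exp_gt_zero[of "- x"] by linarith+
  then show ?thesis by (simp add: logistic_def divide_simps exp_minus)
qed

lemma logistic_alt: "logistic x = exp x / (1 + exp x)"
proof -
  have "1 + exp x \<noteq> 0" "1 + exp (- x) \<noteq> 0" using exp_gt_zero[of x] exp_gt_zero[of "- x"] by linarith+
  then show ?thesis by (simp add: logistic_def divide_simps exp_minus)
qed

lemma has_real_derivative_logistic:
  "(logistic has_real_derivative logistic x * logistic (- x)) (at x)"
proof -
  have pos: "1 + exp (- x) > 0" "1 + exp x > 0" by (simp_all add: add_pos_pos)
  have "((\<lambda>x. 1 / (1 + exp (- x))) has_real_derivative exp (- x) / (1 + exp (- x))\<^sup>2) (at x)"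
    using pos by (auto intro!: derivative_eq_intros simp: power2_eq_square)
  moreover have "exp (- x) / (1 + exp (- x))\<^sup>2 = logistic x * logistic (- x)"
    unfolding logistic_alt[of "- x"] by (simp add: logistic_def power2_eq_square)
  ultimately show ?thesis unfolding logistic_def[abs_def] by simp
qed

lemma strict_mono_logistic: "strict_mono logistic"
  by (rule strict_monoI) (simp add: logistic_def frac_less2 add_pos_pos)

text \<open>For \<open>y \<ge> 0\<close> the product equals \<open>exp (- y)\<close> over the square
  of \<open>1 + exp (- y)\<close>, and that square is at most 4. The product is symmetric in the
  sign of its argument.\<close>

lemma logistic_deriv_ge: "exp (- \<bar>x\<bar>) / 4 \<le> logistic x * logistic (- x)"
proof -
  have *: "exp (- y) / 4 \<le> logistic y * logistic (- y)" if "y \<ge> 0" for y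
  proof -
    have e: "0 < exp (- y)" "exp (- y) \<le> 1" using that by simp_all
    then have "(1 + exp (- y)) * (1 + exp (- y)) \<le> 2 * 2" by (intro mult_mono) auto
    then have "exp (- y) / 4 \<le> exp (- y) / ((1 + exp (- y)) * (1 + exp (- y)))"
      using e by (intro divide_left_mono mult_pos_pos) (auto intro: add_pos_pos)
    also have "\<dots> = logistic y * logistic (- y)"
      unfolding logistic_alt[of "- y"] by (simp add: logistic_def)
    finally show ?thesis .
  qed
  show ?thesis
    using *[of x] *[of "- x"] by (cases "x \<ge> 0") (simp_all add: mult.commute)
qed

text \<open>The mean value theorem; the intermediate point has absolute value at most
  \<open>\<alpha> + 1\<close>. This is the source of the factor \<open>exp (\<alpha> + 1)\<close> in
  the noise condition.\<close>

lemma logistic_increment_ge: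
  assumes x: "\<bar>x\<bar> \<le> \<alpha>" and h: "0 \<le> h" "h \<le> 1"
  shows "exp (- (\<alpha> + 1)) / 4 * h \<le> logistic (x + h) - logistic x"
proof (cases "h = 0")
  case False
  then have "x < x + h" using h by simp
  then obtain z where z: "x < z" "z < x + h"
    "logistic (x + h) - logistic x = (x + h - x) * (logistic z * logistic (- z))"
    using MVT2[of x "x + h" logistic "\<lambda>z. logistic z * logistic (- z)"] has_real_derivative_logistic
    by blast
  have "\<bar>z\<bar> \<le> \<alpha> + 1" using z x h by linarith
  then have "exp (- (\<alpha> + 1)) / 4 \<le> exp (- \<bar>z\<bar>) / 4" by simp
  also have "\<dots> \<le> logistic z * logistic (- z)" by (rule logistic_deriv_ge)
  finally have "exp (- (\<alpha> + 1)) / 4 * h \<le> logistic z * logistic (- z) * h"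
    using h by (intro mult_right_mono) auto
  then show ?thesis using z(3) by (simp add: mult.commute)
qed simp

text \<open>
  The logarithm of the likelihood of the outcome \<open>b\<close> at merit difference \<open>x\<close> is
  \<open>b x - ln (1 + exp x)\<close>, with \<open>b\<close> read as \<open>0\<close> or \<open>1\<close>.
\<close>
definition edge_loglik :: "('a \<times> 'a) set \<Rightarrow> ('a \<times> 'a \<Rightarrow> bool) \<Rightarrow> ('a \<Rightarrow> real) \<Rightarrow> real" where
  "edge_loglik E W v =
     (\<Sum>e\<in>E. of_bool (W e) * (v (fst e) - v (snd e)) - ln (1 + exp (v (fst e) - v (snd e))))"

lemma edge_loglik_cong:
  assumes "\<And>e. e \<in> E \<Longrightarrow> v (fst e) - v (snd e) = v' (fst e) - v' (snd e)"
  shows "edge_loglik E W v = edge_loglik E W v'"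
  unfolding edge_loglik_def using assms by (intro sum.cong) simp_all

lemma ln_one_plus_exp_minus: "ln (1 + exp (- x)) = ln (1 + exp x) - x" for x :: real
proof -
  have "1 + exp x = exp x * (1 + exp (- x))" by (simp add: algebra_simps exp_minus)
  then have "ln (1 + exp x) = ln (exp x * (1 + exp (- x)))" by simp
  also have "\<dots> = x + ln (1 + exp (- x))"
    using exp_gt_zero[of "- x"] by (subst ln_mult_pos) (auto simp: add_pos_pos)
  finally show ?thesis by simp
qed

text \<open>Exchanging winners and losers while negating the merits is a symmetry of the model; it
  turns statements about large errors into statements about very negative ones.\<close>

lemma edge_loglik_reflect: "edge_loglik E (\<lambda>e. \<not> W e) (\<lambda>i. - v i) = edge_loglik E W v"
  unfolding edge_loglik_def
proof (rule sum.cong[OF refl])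
  fix e :: "'a \<times> 'a"
  show "of_bool (\<not> W e) * (- v (fst e) - - v (snd e)) - ln (1 + exp (- v (fst e) - - v (snd e))) =
        of_bool (W e) * (v (fst e) - v (snd e)) - ln (1 + exp (v (fst e) - v (snd e)))"
    using ln_one_plus_exp_minus[of "v (fst e) - v (snd e)"] by (cases "W e") simp_all
qed

lemma residual_reflect: "residual (\<lambda>i. - u i) (\<lambda>e. \<not> W e) e = - residual u W e"
  using logistic_minus[of "u (fst e) - u (snd e)"] by (simp add: residual_def of_bool_def)

lemma has_real_derivative_edge_loglik:
  "((\<lambda>s. edge_loglik E W (\<lambda>i. v i + s * y i)) has_real_derivative
     (\<Sum>e\<in>E. (y (fst e) - y (snd e)) * residual (\<lambda>i. v i + s * y i) W e)) (at s)"
  unfolding edge_loglik_def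
proof (rule DERIV_sum)
  fix e assume "e \<in> E"
  let ?a = "v (fst e) - v (snd e)" and ?b = "y (fst e) - y (snd e)"
  let ?x = "?a + s * ?b"
  have pos: "1 + exp z > 0" for z :: real by (simp add: add_pos_pos)
  have "((\<lambda>s. of_bool (W e) * (?a + s * ?b) - ln (1 + exp (?a + s * ?b))) has_real_derivative
        of_bool (W e) * ?b - exp ?x * ?b / (1 + exp ?x)) (at s)"
    using pos by (auto intro!: derivative_eq_intros)
  moreover have "of_bool (W e) * ?b - exp ?x * ?b / (1 + exp ?x) = ?b * (of_bool (W e) - logistic ?x)"
    by (simp add: logistic_alt algebra_simps)
  moreover have "?a + s * ?b = v (fst e) + s * y (fst e) - (v (snd e) + s * y (snd e))" for s
    by (simp add: algebra_simps)
  ultimately show "((\<lambda>s. of_bool (W e) * (v (fst e) + s * y (fst e) - (v (snd e) + s * y (snd e)))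
      - ln (1 + exp (v (fst e) + s * y (fst e) - (v (snd e) + s * y (snd e))))) has_real_derivative
      ?b * residual (\<lambda>i. v i + s * y i) W e) (at s)"
    by (simp add: residual_def)
qed

text \<open>A maximizer over a box may lie on the boundary, where only directions into the box are
  admissible. The first-order condition is therefore one-sided.\<close>

lemma edge_loglik_ascent_le:
  assumes "h > 0" and max: "\<And>s. 0 < s \<Longrightarrow> s < h \<Longrightarrow> edge_loglik E W (\<lambda>i. v i + s * y i) \<le> edge_loglik E W v"
  shows "(\<Sum>e\<in>E. (y (fst e) - y (snd e)) * residual v W e) \<le> 0"
proof (rule ccontr)
  let ?g = "\<lambda>s. edge_loglik E W (\<lambda>i. v i + s * y i)"
  assume "\<not> ?thesis"
  then obtain h' where h': "h' > 0" "\<And>s. 0 < s \<Longrightarrow> s < h' \<Longrightarrow> ?g 0 < ?g (0 + s)"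
    using DERIV_pos_inc_right[OF has_real_derivative_edge_loglik[of E W v y 0]] by auto
  define s where "s = min h h' / 2"
  have s: "0 < s" "s < h" "s < h'" using h'(1) assms(1) unfolding s_def by linarith+
  show False using h'(2)[OF s(1,3)] max[OF s(1,2)] by simp
qed

text \<open>Strict concavity along lines, up to directions that are constant on every edge.\<close>
lemma edge_loglik_local_max_global:
  assumes fin: "finite E" and "h > 0"
    and max: "\<And>s. \<bar>s\<bar> < h \<Longrightarrow> edge_loglik E W (\<lambda>i. v i + s * (x i - v i)) \<le> edge_loglik E W v"
  shows "edge_loglik E W x \<le> edge_loglik E W v"
    and "edge_loglik E W x = edge_loglik E W v \<Longrightarrow> e \<in> E \<Longrightarrow> x (fst e) - v (fst e) = x (snd e) - v (snd e)"
proof -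
  let ?y = "\<lambda>i. x i - v i"
  let ?g = "\<lambda>s. edge_loglik E W (\<lambda>i. v i + s * ?y i)"
  let ?g' = "\<lambda>s. \<Sum>e\<in>E. (?y (fst e) - ?y (snd e)) * residual (\<lambda>i. v i + s * ?y i) W e"
  \<comment> \<open>Both signs of \<open>s\<close> are admissible here, so the derivative vanishes
    at 0. Comparison with the derivative at a mean value point \<open>z\<close> then gives the
    claim.\<close>
  have g0: "?g' 0 = 0"
    using max by (intro DERIV_local_max[OF has_real_derivative_edge_loglik assms(2)]) auto
  obtain z where z: "0 < z" "z < 1" "?g 1 - ?g 0 = (1 - 0) * ?g' z"
    using MVT2[of 0 1 ?g ?g'] has_real_derivative_edge_loglik[of E W v ?y] by auto
  have term_le: "(?y (fst e) - ?y (snd e)) * residual (\<lambda>i. v i + z * ?y i) W e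
        \<le> (?y (fst e) - ?y (snd e)) * residual (\<lambda>i. v i + 0 * ?y i) W e"
    and term_less: "?y (fst e) - ?y (snd e) \<noteq> 0 \<Longrightarrow>
        (?y (fst e) - ?y (snd e)) * residual (\<lambda>i. v i + z * ?y i) W e
        < (?y (fst e) - ?y (snd e)) * residual (\<lambda>i. v i + 0 * ?y i) W e" for e
  proof -
    let ?b = "?y (fst e) - ?y (snd e)" and ?a = "v (fst e) - v (snd e)"
    have eq: "residual (\<lambda>i. v i + s * ?y i) W e = of_bool (W e) - logistic (?a + s * ?b)" for s
      by (simp add: residual_def algebra_simps)
    have less: "?b * logistic ?a < ?b * logistic (?a + z * ?b)" if "?b \<noteq> 0"
    proof (cases "?b > 0")
      case True
      then have "logistic ?a < logistic (?a + z * ?b)"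
        using z by (intro strict_monoD[OF strict_mono_logistic]) simp
      then show ?thesis using True by (intro mult_strict_left_mono) auto
    next
      case False
      then have b: "?b < 0" using that by simp
      then have "logistic (?a + z * ?b) < logistic ?a"
        using z by (intro strict_monoD[OF strict_mono_logistic]) (simp add: mult_pos_neg)
      then show ?thesis using b by (intro mult_strict_left_mono_neg) auto
    qed
    then show "?b \<noteq> 0 \<Longrightarrow> ?b * residual (\<lambda>i. v i + z * ?y i) W e < ?b * residual (\<lambda>i. v i + 0 * ?y i) W e"
      unfolding eq by (simp only: right_diff_distrib) simp
    then show "?b * residual (\<lambda>i. v i + z * ?y i) W e \<le> ?b * residual (\<lambda>i. v i + 0 * ?y i) W e"
      by (cases "?b = 0") auto
  qed
  have "?g' z \<le> ?g' 0" by (intro sum_mono term_le)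
  then show "edge_loglik E W x \<le> edge_loglik E W v" using z g0 by simp
  show "x (fst e) - v (fst e) = x (snd e) - v (snd e)"
    if eq: "edge_loglik E W x = edge_loglik E W v" and e: "e \<in> E"
  proof (rule ccontr)
    assume ne: "\<not> ?thesis"
    have "?g' z < ?g' 0"
    proof (intro sum_strict_mono_ex1 fin ballI term_le)
      show "\<exists>e\<in>E. (?y (fst e) - ?y (snd e)) * residual (\<lambda>i. v i + z * ?y i) W e
          < (?y (fst e) - ?y (snd e)) * residual (\<lambda>i. v i + 0 * ?y i) W e"
        using ne by (intro bexI[OF _ e] term_less) simp
    qed
    then show False using z g0 eq by simp
  qed
qed

text \<open>A continuous function attains its maximum on a product of compact intervals. The product
  runs over the whole index type; a competitor is reset to \<open>u\<close> outside
  \<open>V\<close>, which leaves its likelihood unchanged.\<close>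

lemma edge_loglik_box_max:
  fixes u :: "'a \<Rightarrow> real"
  assumes fin: "finite V" and E: "E \<subseteq> V \<times> V" and r: "r \<ge> 0"
  obtains v where "\<And>i. i \<in> V \<Longrightarrow> \<bar>v i - u i\<bar> \<le> r"
    "\<And>v'. (\<And>i. i \<in> V \<Longrightarrow> \<bar>v' i - u i\<bar> \<le> r) \<Longrightarrow> edge_loglik E W v' \<le> edge_loglik E W v"
proof -
  let ?S = "PiE UNIV (\<lambda>i. {u i - r..u i + r})"
  have "compactin (product_topology (\<lambda>i. euclidean) UNIV) ?S"
    by (subst compactin_PiE) simp
  then have comp: "compact ?S" by (simp add: euclidean_product_topology)
  have ne: "?S \<noteq> {}" using r by (auto simp: PiE_eq_empty_iff)
  have cont: "continuous_on ?S (edge_loglik E W)"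
  proof -
    have "1 + exp z \<noteq> 0" for z :: real using exp_gt_zero[of z] by linarith
    then show ?thesis unfolding edge_loglik_def
      by (intro continuous_intros continuous_on_product_coordinates continuous_on_subset[OF continuous_on_product_coordinates]) auto
  qed
  obtain v where v: "v \<in> ?S" "\<forall>v'\<in>?S. edge_loglik E W v' \<le> edge_loglik E W v"
    using continuous_attains_sup[OF comp ne cont] by (rule bexE)
  show thesis
  proof
    show "\<bar>v i - u i\<bar> \<le> r" if "i \<in> V" for i
    proof -
      have "v i \<in> {u i - r..u i + r}" using v(1) by (rule PiE_mem) simp
      then show ?thesis by (simp add: abs_le_iff)
    qed
    fix v' assume v': "\<And>i. i \<in> V \<Longrightarrow> \<bar>v' i - u i\<bar> \<le> r"
    let ?v'' = "\<lambda>i. if i \<in> V then v' i else u i"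
    have "edge_loglik E W v' = edge_loglik E W ?v''"
      using E by (intro edge_loglik_cong) auto
    also have "\<dots> \<le> edge_loglik E W v"
    proof (rule v(2)[rule_format], rule PiE_I)
      fix i
      show "?v'' i \<in> {u i - r..u i + r}"
        using v'[of i] r by (cases "i \<in> V") (auto simp: abs_le_iff)
    qed simp
    finally show "edge_loglik E W v' \<le> edge_loglik E W v" .
  qed
qed

section \<open>Maximizers on an expander\<close>

context bipartite_expander
begin

text \<open>After \<open>K\<close> growth steps, a set that is still not large would have more edges
  than the graph.\<close>

definition expansion_depth :: "nat \<Rightarrow> bool" where
  "expansion_depth K \<longleftrightarrow> real (card L) * d < (mean_degree / (16 * C)) ^ K"

text \<open>No edge leaves a level set of \<open>y\<close>, so the constant chain at that level set
  shows that it contains more than half of \<open>L\<close>. Two distinct values would give disjoint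
  majorities.\<close>

lemma constant_on_edges_constant:
  assumes K: "expansion_depth K"
    and edges: "\<And>e. e \<in> E \<Longrightarrow> y (fst e) = y (snd e)"
    and a: "a \<in> L \<union> R" and b: "b \<in> L \<union> R"
  shows "y a = y b"
proof (rule ccontr)
  assume ne: "y a \<noteq> y b"
  have half: "card L < 2 * card ({i \<in> L \<union> R. y i = y c} \<inter> L)" if c: "c \<in> L \<union> R" for c
  proof -
    let ?D = "{i \<in> L \<union> R. y i = y c}"
    have "E \<inter> (?D \<inter> L) \<times> (R - ?D) = {}" "E \<inter> (L - ?D) \<times> (?D \<inter> R) = {}"
      using edges by fastforce+
    then have "leaving ?D ?D = 0" unfolding leaving_def by (simp only: card.empty)
    then show ?thesis
      using chain_covers_half[of "\<lambda>_. ?D" K] c K unfolding expansion_depth_def by auto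
  qed
  let ?A = "{i \<in> L \<union> R. y i = y a} \<inter> L" and ?B = "{i \<in> L \<union> R. y i = y b} \<inter> L"
  have "card ?A + card ?B = card (?A \<union> ?B)"
    using ne finite_L by (intro card_Un_disjoint[symmetric]) auto
  also have "\<dots> \<le> card L" using finite_L by (intro card_mono) auto
  finally show False using half[OF a] half[OF b] by linarith
qed

text \<open>The signed sum over edges is regrouped by the vertices of \<open>D\<close>, and the
  noise bound is applied at each vertex. Edges inside \<open>D\<close> enter twice with opposite
  signs.\<close>

lemma volume_noise_le:
  assumes noise: "small_noise L R \<kappa> u E W"
  shows "(\<Sum>e\<in>E. (of_bool (fst e \<in> D) - of_bool (snd e \<in> D)) * residual u W e) \<le> \<kappa> * volume D"
proof -
  have left: "(\<Sum>e\<in>E. of_bool (fst e \<in> D) * residual u W e) \<le> \<kappa> * card (E \<inter> (D \<inter> L) \<times> R)"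
  proof -
    have U: "E \<inter> (D \<inter> L) \<times> R = (\<Union>i\<in>D \<inter> L. E \<inter> {i} \<times> R)" by auto
    have "(\<Sum>e\<in>E. of_bool (fst e \<in> D) * residual u W e) = (\<Sum>e\<in>E \<inter> (D \<inter> L) \<times> R. residual u W e)"
      using finite_E edges_sub by (intro sum.mono_neutral_cong_right) auto
    also have "\<dots> = (\<Sum>i\<in>D \<inter> L. \<Sum>e\<in>E \<inter> {i} \<times> R. residual u W e)"
      unfolding U using finite_E finite_L by (intro sum.UNION_disjoint) auto
    also have "\<dots> \<le> (\<Sum>i\<in>D \<inter> L. \<kappa> * card (E \<inter> {i} \<times> R))"
      using noise unfolding small_noise_def by (intro sum_mono) (auto simp: abs_le_iff)
    also have "\<dots> = \<kappa> * card (E \<inter> (D \<inter> L) \<times> R)"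
      unfolding U using finite_E finite_L
      by (subst card_UN_disjoint) (auto simp: sum_distrib_left)
    finally show ?thesis .
  qed
  have right: "- (\<Sum>e\<in>E. of_bool (snd e \<in> D) * residual u W e) \<le> \<kappa> * card (E \<inter> L \<times> (D \<inter> R))"
  proof -
    have U: "E \<inter> L \<times> (D \<inter> R) = (\<Union>j\<in>D \<inter> R. E \<inter> L \<times> {j})" by auto
    have "(\<Sum>e\<in>E. of_bool (snd e \<in> D) * residual u W e) = (\<Sum>e\<in>E \<inter> L \<times> (D \<inter> R). residual u W e)"
      using finite_E edges_sub by (intro sum.mono_neutral_cong_right) auto
    also have "\<dots> = (\<Sum>j\<in>D \<inter> R. \<Sum>e\<in>E \<inter> L \<times> {j}. residual u W e)"
      unfolding U using finite_E finite_R by (intro sum.UNION_disjoint) auto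
    also have "- \<dots> = (\<Sum>j\<in>D \<inter> R. - (\<Sum>e\<in>E \<inter> L \<times> {j}. residual u W e))"
      by (simp add: sum_negf)
    also have "\<dots> \<le> (\<Sum>j\<in>D \<inter> R. \<kappa> * card (E \<inter> L \<times> {j}))"
      using noise unfolding small_noise_def by (intro sum_mono) (auto simp: abs_le_iff)
    also have "\<dots> = \<kappa> * card (E \<inter> L \<times> (D \<inter> R))"
      unfolding U using finite_E finite_R
      by (subst card_UN_disjoint) (auto simp: sum_distrib_left)
    finally show ?thesis .
  qed
  show ?thesis
    using left right by (simp add: volume_def left_diff_distrib sum_subtractf distrib_left)
qed

end

section \<open>Level sets of the error of a box maximizer\<close>

text \<open>\<open>noise_level\<close> is \<open>\<kappa> \<le> c * t / 2 ^ 15\<close>, cleared of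
  denominators, for the descent step \<open>t = r / (K + 3)\<close> and the slope bound
  \<open>c = exp (- (\<alpha> + 1)) / 4\<close>. The bound \<open>r \<le> 1 / 2\<close> keeps
  differences of errors within 1, as \<open>logistic_increment_ge\<close> requires.\<close>

locale btl_sample = bipartite_expander L R E d C
  for L R :: "'a set" and E d C +
  fixes u :: "'a \<Rightarrow> real" and W :: "'a \<times> 'a \<Rightarrow> bool" and \<kappa> \<alpha> r :: real and K :: nat
  assumes noise: "small_noise L R \<kappa> u E W"
    and merits: "\<And>i j. i \<in> L \<union> R \<Longrightarrow> j \<in> L \<union> R \<Longrightarrow> u i - u j \<le> \<alpha>"
    and r_pos: "0 < r" and r_le: "r \<le> 1 / 2"
    and depth: "expansion_depth K"
    and noise_level: "\<kappa> * (4 * exp (\<alpha> + 1)) * 2 ^ 15 * (K + 3) \<le> r"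
begin

lemma reflected: "btl_sample L R E d C (\<lambda>i. - u i) (\<lambda>e. \<not> W e) \<kappa> \<alpha> r K"
proof
  show "small_noise L R \<kappa> (\<lambda>i. - u i) E (\<lambda>e. \<not> W e)"
    using noise by (simp add: small_noise_def residual_reflect sum_negf)
  show "- u i - - u j \<le> \<alpha>" if "i \<in> L \<union> R" "j \<in> L \<union> R" for i j
    using merits[OF that(2,1)] by simp
qed (use r_pos r_le depth noise_level in auto)

definition box_max :: "('a \<Rightarrow> real) \<Rightarrow> bool" where
  "box_max v \<longleftrightarrow> (\<forall>i\<in>L \<union> R. \<bar>v i - u i\<bar> \<le> r) \<and>
     (\<forall>v'. (\<forall>i\<in>L \<union> R. \<bar>v' i - u i\<bar> \<le> r) \<longrightarrow> edge_loglik E W v' \<le> edge_loglik E W v)"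

text \<open>
  Lowering \<open>v\<close> on the top level set \<open>D\<close> stays in the box and cannot increase the likelihood;
  in the resulting inequality the noise of the edges inside \<open>D\<close> cancels.
\<close>
lemma level_set_leaving:
  assumes v: "box_max v" and s: "- r < s" and t: "0 \<le> t"
  defines "D \<equiv> {i \<in> L \<union> R. s \<le> v i - u i}" and "D' \<equiv> {i \<in> L \<union> R. s - t \<le> v i - u i}"
  shows "exp (- (\<alpha> + 1)) / 4 * t * leaving D D' \<le> \<kappa> * volume D"
proof -
  let ?w = "\<lambda>i. v i - u i" and ?c = "exp (- (\<alpha> + 1)) / 4"
  let ?\<sigma> = "\<lambda>e. of_bool (fst e \<in> D) - of_bool (snd e \<in> D) :: real"
  have box: "\<bar>?w i\<bar> \<le> r" if "i \<in> L \<union> R" for i using v that by (simp add: box_max_def)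
  \<comment> \<open>The errors on \<open>D\<close> are at least \<open>s\<close>, so they can be
    lowered by any amount below \<open>s + r\<close> without leaving the box.\<close>
  have "(\<Sum>e\<in>E. (- of_bool (fst e \<in> D) - (- of_bool (snd e \<in> D))) * residual v W e) \<le> 0"
  proof (rule edge_loglik_ascent_le[where h = "s + r" and y = "\<lambda>i. - of_bool (i \<in> D)"])
    fix \<tau> assume \<tau>: "0 < \<tau>" "\<tau> < s + r"
    have "\<bar>v i + \<tau> * - of_bool (i \<in> D) - u i\<bar> \<le> r" if "i \<in> L \<union> R" for i
      using box[OF that] \<tau> by (cases "i \<in> D") (auto simp: D_def abs_le_iff)
    then show "edge_loglik E W (\<lambda>i. v i + \<tau> * - of_bool (i \<in> D)) \<le> edge_loglik E W v"
      using v by (simp add: box_max_def)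
  qed (use s in auto)
  then have opt: "0 \<le> (\<Sum>e\<in>E. ?\<sigma> e * residual v W e)"
    by (simp add: sum_negf[symmetric] sum_subtractf left_diff_distrib)
  \<comment> \<open>Across the boundary of \<open>D\<close> the error is larger on the inner end, so
    the model probability of a win exceeds the true one. The excess is at least
    \<open>?c * t\<close> if the outer end lies outside \<open>D'\<close>. For the other edges both
    sides vanish.\<close>
  have edge: "?c * t * (of_bool (fst e \<in> D \<and> snd e \<notin> D') + of_bool (fst e \<notin> D' \<and> snd e \<in> D))
      \<le> ?\<sigma> e * (residual u W e - residual v W e)" if e: "e \<in> E" for e
  proof -
    obtain i j where ij: "e = (i, j)" "i \<in> L" "j \<in> R" using e edges_sub by blast
    have sub: "D \<subseteq> D'" using t by (auto simp: D_def D'_def)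
    have c: "?c > 0" by simp
    have increment: "?c * t * of_bool (b \<notin> D') \<le> logistic (v a - v b) - logistic (u a - u b)"
      if ab: "a \<in> D" "b \<notin> D" "b \<in> L \<union> R" for a b
    proof -
      have a: "a \<in> L \<union> R" using ab by (simp add: D_def)
      have h: "0 \<le> ?w a - ?w b" "?w a - ?w b \<le> 1" "of_bool (b \<notin> D') * t \<le> ?w a - ?w b"
        using ab box[OF a] box[OF ab(3)] r_le by (auto simp: D_def D'_def abs_le_iff)
      have "\<bar>u a - u b\<bar> \<le> \<alpha>" using merits[OF a ab(3)] merits[OF ab(3) a] by linarith
      then have inc: "?c * (?w a - ?w b) \<le> logistic (u a - u b + (?w a - ?w b)) - logistic (u a - u b)"
        using h by (intro logistic_increment_ge)
      have "?c * t * of_bool (b \<notin> D') = ?c * (of_bool (b \<notin> D') * t)" by (simp only: mult_ac)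
      also have "\<dots> \<le> ?c * (?w a - ?w b)"
        using h(3) c by (intro mult_left_mono) auto
      also note inc
      also have "u a - u b + (?w a - ?w b) = v a - v b" by simp
      finally show ?thesis .
    qed
    have res: "residual u W e - residual v W e = logistic (v i - v j) - logistic (u i - u j)"
      by (simp add: residual_def ij)
    consider "i \<in> D" "j \<notin> D" | "i \<notin> D" "j \<in> D" | "i \<in> D \<longleftrightarrow> j \<in> D" by blast
    then show ?thesis
    proof cases
      case 1
      then show ?thesis using increment[of i j] ij unfolding res by (simp add: ij)
    next
      case 2
      then show ?thesis using increment[of j i] ij logistic_minus[of "v j - v i"] logistic_minus[of "u j - u i"]
        unfolding res by (simp add: ij)
    next
      case 3
      then show ?thesis using sub by (auto simp: ij)
    qed
  qed
  have "?c * t * leaving D D' = (\<Sum>e\<in>E. ?c * t * (of_bool (fst e \<in> D \<and> snd e \<notin> D') + of_bool (fst e \<notin> D' \<and> snd e \<in> D)))"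
  proof -
    have "(\<Sum>e\<in>E. of_bool (fst e \<in> D \<and> snd e \<notin> D') :: real) = card (E \<inter> (D \<inter> L) \<times> (R - D'))"
      using finite_E edges_sub by (subst sum_of_bool_eq) (auto intro!: arg_cong[of _ _ card])
    moreover have "(\<Sum>e\<in>E. of_bool (fst e \<notin> D' \<and> snd e \<in> D) :: real) = card (E \<inter> (L - D') \<times> (D \<inter> R))"
      using finite_E edges_sub by (subst sum_of_bool_eq) (auto intro!: arg_cong[of _ _ card])
    ultimately show ?thesis
      by (simp only: sum_distrib_left[symmetric] sum.distrib leaving_def of_nat_add)
  qed
  also have "\<dots> \<le> (\<Sum>e\<in>E. ?\<sigma> e * (residual u W e - residual v W e))"
    by (intro sum_mono edge)
  also have "\<dots> = (\<Sum>e\<in>E. ?\<sigma> e * residual u W e) - (\<Sum>e\<in>E. ?\<sigma> e * residual v W e)"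
    by (simp add: right_diff_distrib sum_subtractf)
  also have "\<dots> \<le> \<kappa> * volume D"
    using opt volume_noise_le[OF noise, of D] by linarith
  finally show ?thesis .
qed

text \<open>The level sets descending from \<open>r\<close> in steps of \<open>t\<close> form a
  chain to which \<open>chain_covers_half\<close> applies; its last member still lies above
  0.\<close>

lemma top_half:
  assumes v: "box_max v" and top: "a \<in> L \<union> R" "v a - u a = r"
  shows "card L < 2 * card {i \<in> L. 0 < v i - u i}"
proof -
  \<comment> \<open>With \<open>K + 3\<close> parts, the \<open>K + 2\<close> steps of the chain end
    at level \<open>t\<close>, which is positive.\<close>
  define t where "t = r / (K + 3)"
  define D where "D k = {i \<in> L \<union> R. r - k * t \<le> v i - u i}" for k :: nat
  have t: "t > 0" "(K + 3) * t = r" using r_pos by (simp_all add: t_def)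
  have "card L < 2 * card (D (K + 2) \<inter> L)"
  proof (rule chain_covers_half)
    show "D 0 \<noteq> {}" using top by (auto simp: D_def)
    show "D 0 \<subseteq> L \<union> R" by (auto simp: D_def)
    show "D k \<subseteq> D (Suc k)" for k using t by (auto simp: D_def algebra_simps)
    show "real (card L) * d < (mean_degree / (16 * C)) ^ K" using depth by (simp add: expansion_depth_def)
    fix k assume k: "k < K + 2"
    let ?c = "exp (- (\<alpha> + 1)) / 4"
    have "real k * t < (K + 3) * t" using k t by (intro mult_strict_right_mono) auto
    then have "- r < r - k * t" using t r_pos by linarith
    then have "?c * t * leaving (D k) {i \<in> L \<union> R. r - k * t - t \<le> v i - u i} \<le> \<kappa> * volume (D k)"
      unfolding D_def using t by (intro level_set_leaving[OF v]) auto
    moreover have "{i \<in> L \<union> R. r - k * t - t \<le> v i - u i} = D (Suc k)"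
      by (simp add: D_def algebra_simps)
    ultimately have "?c * t * leaving (D k) (D (Suc k)) \<le> \<kappa> * volume (D k)" by simp
    \<comment> \<open>Here \<open>noise_level\<close> is solved for \<open>\<kappa>\<close>;
      dividing by \<open>?c * t\<close> afterwards leaves the proportion \<open>1 / 2 ^ 15\<close>
      of the volume.\<close>
    also have "\<dots> \<le> (?c * t / 2 ^ 15) * volume (D k)"
    proof (rule mult_right_mono)
      have "\<kappa> * 2 ^ 15 * (K + 3) * (4 * exp (\<alpha> + 1)) \<le> (K + 3) * t"
        using noise_level unfolding t(2) by (simp only: mult_ac)
      then have "\<kappa> * 2 ^ 15 * (4 * exp (\<alpha> + 1)) * (K + 3) \<le> t * (K + 3)" by (simp only: mult_ac)
      then have "\<kappa> * 2 ^ 15 * (4 * exp (\<alpha> + 1)) \<le> t" by (rule mult_right_le_imp_le) simp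
      then have "\<kappa> * 2 ^ 15 * (4 * exp (\<alpha> + 1)) * (?c / 2 ^ 15) \<le> t * (?c / 2 ^ 15)"
        by (rule mult_right_mono) simp
      moreover have "exp (\<alpha> + 1) * exp (- (\<alpha> + 1)) = 1" by (simp only: exp_add[symmetric]) simp
      then have "\<kappa> * 2 ^ 15 * (4 * exp (\<alpha> + 1)) * (?c / 2 ^ 15) = \<kappa>" by (simp add: mult_ac)
      ultimately show "\<kappa> \<le> ?c * t / 2 ^ 15" by (simp only: mult_ac) (simp add: mult_ac)
    qed simp
    finally have "(?c * t) * leaving (D k) (D (Suc k)) \<le> (?c * t) * (volume (D k) / 2 ^ 15)" by simp
    then show "real (leaving (D k) (D (Suc k))) \<le> real (volume (D k)) / 2 ^ 15"
      using t by (subst (asm) mult_le_cancel_left_pos) auto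
  qed
  also have "card (D (K + 2) \<inter> L) \<le> card {i \<in> L. 0 < v i - u i}"
  proof (rule card_mono)
    have "(K + 2) * t < r" using t by (simp add: algebra_simps)
    then show "D (K + 2) \<inter> L \<subseteq> {i \<in> L. 0 < v i - u i}" by (auto simp: D_def)
  qed (use finite_L in simp)
  finally show ?thesis by simp
qed

text \<open>This is \<open>top_half\<close> for the reflected sample, in which \<open>- v\<close> is
  again a box maximizer.\<close>

lemma bottom_half:
  assumes v: "box_max v" and bot: "a \<in> L \<union> R" "v a - u a = - r"
  shows "card L < 2 * card {i \<in> L. v i - u i < 0}"
proof -
  interpret refl: btl_sample L R E d C "\<lambda>i. - u i" "\<lambda>e. \<not> W e" \<kappa> \<alpha> r K
    by (rule reflected)
  have "refl.box_max (\<lambda>i. - v i)"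
    unfolding refl.box_max_def
  proof (intro conjI allI impI)
    show "\<forall>i\<in>L \<union> R. \<bar>- v i - - u i\<bar> \<le> r"
      using v by (simp add: box_max_def abs_minus_commute)
    fix v' assume v': "\<forall>i\<in>L \<union> R. \<bar>v' i - - u i\<bar> \<le> r"
    have "\<forall>i\<in>L \<union> R. \<bar>- v' i - u i\<bar> \<le> r"
    proof
      fix i assume "i \<in> L \<union> R"
      then show "\<bar>- v' i - u i\<bar> \<le> r" using bspec[OF v', of i] by linarith
    qed
    then have "edge_loglik E W (\<lambda>i. - v' i) \<le> edge_loglik E W v" using v by (simp add: box_max_def)
    then show "edge_loglik E (\<lambda>e. \<not> W e) v' \<le> edge_loglik E (\<lambda>e. \<not> W e) (\<lambda>i. - v i)"
      using edge_loglik_reflect[of E W "\<lambda>i. - v' i"] edge_loglik_reflect[of E W v] by simp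
  qed
  moreover have "- v a - - u a = r" using bot by simp
  ultimately have "card L < 2 * card {i \<in> L. 0 < - v i - - u i}"
    using refl.top_half[of "\<lambda>i. - v i" a] bot by simp
  then show ?thesis by simp
qed

text \<open>A box maximizer whose error spans the whole interval \<open>[-r, r]\<close> is impossible; after centering, it is interior.\<close>
lemma maximizer_exists:
  obtains v where "\<And>i. i \<in> L \<union> R \<Longrightarrow> \<bar>v i - u i\<bar> < r"
    "\<And>x. edge_loglik E W x \<le> edge_loglik E W v"
    "\<And>x e. edge_loglik E W x = edge_loglik E W v \<Longrightarrow> e \<in> E \<Longrightarrow> x (fst e) - v (fst e) = x (snd e) - v (snd e)"
proof -
  let ?V = "L \<union> R"
  have finV: "finite ?V" "?V \<noteq> {}" using finite_L finite_R L_nonempty by auto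
  have EV: "E \<subseteq> ?V \<times> ?V" using edges_sub by auto
  obtain v0 where v0: "box_max v0"
  proof (rule edge_loglik_box_max[OF finV(1) EV less_imp_le[OF r_pos], of u W])
    fix v
    assume "\<And>i. i \<in> ?V \<Longrightarrow> \<bar>v i - u i\<bar> \<le> r"
      "\<And>v'. (\<And>i. i \<in> ?V \<Longrightarrow> \<bar>v' i - u i\<bar> \<le> r) \<Longrightarrow> edge_loglik E W v' \<le> edge_loglik E W v"
    then have "box_max v" unfolding box_max_def by simp
    then show thesis by (rule that)
  qed
  let ?w = "\<lambda>i. v0 i - u i"
  define p q where "p = Max (?w ` ?V)" and "q = Min (?w ` ?V)"
  have pq: "q \<le> ?w i" "?w i \<le> p" if "i \<in> ?V" for i
    using finV that by (simp_all add: p_def q_def)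
  obtain a b where ab: "a \<in> ?V" "?w a = p" "b \<in> ?V" "?w b = q"
    using Max_in[of "?w ` ?V"] Min_in[of "?w ` ?V"] finV unfolding p_def q_def by fastforce
  have bounds: "p \<le> r" "- r \<le> q"
  proof -
    have "\<bar>?w a\<bar> \<le> r" "\<bar>?w b\<bar> \<le> r" using v0 ab(1,3) unfolding box_max_def by simp_all
    then show "p \<le> r" "- r \<le> q" using ab(2,4) by linarith+
  qed
  have "p \<noteq> r \<or> q \<noteq> - r"
  proof (rule ccontr)
    assume "\<not> (p \<noteq> r \<or> q \<noteq> - r)"
    then have "card L < 2 * card {i \<in> L. 0 < ?w i}" "card L < 2 * card {i \<in> L. ?w i < 0}"
      using top_half[OF v0 ab(1)] bottom_half[OF v0 ab(3)] ab by simp_all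
    moreover have "card {i \<in> L. 0 < ?w i} + card {i \<in> L. ?w i < 0} = card ({i \<in> L. 0 < ?w i} \<union> {i \<in> L. ?w i < 0})"
      using finite_L by (intro card_Un_disjoint[symmetric]) auto
    moreover have "card ({i \<in> L. 0 < ?w i} \<union> {i \<in> L. ?w i < 0}) \<le> card L"
      using finite_L by (intro card_mono) auto
    ultimately show False by linarith
  qed
  then have width: "p - q < 2 * r" using bounds by linarith
  define v where "v = (\<lambda>i. v0 i - (p + q) / 2)"
  have v_v0: "edge_loglik E W v = edge_loglik E W v0"
    by (rule edge_loglik_cong) (simp add: v_def)
  have inner: "\<bar>v i - u i\<bar> \<le> (p - q) / 2" if "i \<in> ?V" for i
    using pq[OF that] by (simp add: v_def abs_le_iff field_simps)
  define \<delta> where "\<delta> = r - (p - q) / 2"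
  have \<delta>: "\<delta> > 0" using width by (simp add: \<delta>_def)
  have near: "\<exists>h>0. \<forall>s. \<bar>s\<bar> < h \<longrightarrow> edge_loglik E W (\<lambda>i. v i + s * (x i - v i)) \<le> edge_loglik E W v" for x
  proof -
    \<comment> \<open>\<open>B\<close> dominates every coordinate of \<open>x - v\<close>, so a step
      shorter than \<open>\<delta> / B\<close> moves each coordinate by at most the slack
      \<open>\<delta>\<close>. The summand 1 makes \<open>B\<close> positive.\<close>
    define B where "B = (\<Sum>i\<in>?V. \<bar>x i - v i\<bar>) + 1"
    have B: "B > 0" "\<bar>x i - v i\<bar> \<le> B" if "i \<in> ?V" for i
      using finV member_le_sum[of i ?V "\<lambda>i. \<bar>x i - v i\<bar>"] that
      by (auto simp: B_def intro!: add_nonneg_pos sum_nonneg)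
    have Bpos: "B > 0" using finV B by blast
    have "edge_loglik E W (\<lambda>i. v i + s * (x i - v i)) \<le> edge_loglik E W v" if s: "\<bar>s\<bar> < \<delta> / B" for s
    proof -
      have "\<bar>v i + s * (x i - v i) - u i\<bar> \<le> r" if i: "i \<in> ?V" for i
      proof -
        have "\<bar>s * (x i - v i)\<bar> \<le> \<delta> / B * B"
          unfolding abs_mult using s B[OF i] by (intro mult_mono) auto
        then have "\<bar>s * (x i - v i)\<bar> \<le> \<delta>" using Bpos by simp
        then show ?thesis using inner[OF i] unfolding \<delta>_def by arith
      qed
      then show ?thesis using v0 v_v0 by (simp add: box_max_def)
    qed
    then show ?thesis using \<delta> Bpos by (intro exI[of _ "\<delta> / B"]) auto
  qed
  show thesis
  proof
    show "\<bar>v i - u i\<bar> < r" if "i \<in> ?V" for i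
    proof -
      have "(p - q) / 2 < r" using width by simp
      with inner[OF that] show ?thesis by (rule order.strict_trans1)
    qed
    show "edge_loglik E W x \<le> edge_loglik E W v" for x
    proof -
      obtain h where "h > 0" "\<And>s. \<bar>s\<bar> < h \<Longrightarrow> edge_loglik E W (\<lambda>i. v i + s * (x i - v i)) \<le> edge_loglik E W v"
        using near[of x] by blast
      then show ?thesis by (rule edge_loglik_local_max_global(1)[OF finite_E])
    qed
    show "x (fst e) - v (fst e) = x (snd e) - v (snd e)"
      if "edge_loglik E W x = edge_loglik E W v" "e \<in> E" for x e
    proof -
      obtain h where "h > 0" "\<And>s. \<bar>s\<bar> < h \<Longrightarrow> edge_loglik E W (\<lambda>i. v i + s * (x i - v i)) \<le> edge_loglik E W v"
        using near[of x] by blast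
      then show ?thesis using that by (rule edge_loglik_local_max_global(2)[OF finite_E])
    qed
  qed
qed

end

section \<open>Consistency\<close>

text \<open>The double sum meets each edge in both orientations, and exactly the winner's
  orientation has weight 1. With \<open>x\<close> the difference from left to right, a left win
  contributes \<open>x - ln (1 + exp x)\<close> and a right win
  \<open>- ln (1 + exp x)\<close>.\<close>

lemma log_likelihood_win_matrix:
  assumes E: "E \<subseteq> {1..n} \<times> {n+1..n+m}"
  shows "log_likelihood (n + m) (win_matrix (E, W)) v = edge_loglik E W v"
proof -
  let ?V = "{1..n+m}"
  let ?f = "\<lambda>i j. ln (logistic (v i - v j))"
  have finE: "finite E" and EV: "E \<subseteq> ?V \<times> ?V"
    using E finite_subset[of E "{1..n} \<times> {n+1..n+m}"] by auto
  have no_both: "\<not> ((i, j) \<in> E \<and> (j, i) \<in> E)" for i j using subsetD[OF E, of "(i, j)"] subsetD[OF E, of "(j, i)"] by auto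
  have split: "win_matrix (E, W) i j * ?f i j
      = of_bool ((i, j) \<in> E) * (of_bool (W (i, j)) * ?f i j) + of_bool ((j, i) \<in> E) * (of_bool (\<not> W (j, i)) * ?f i j)" for i j
    using no_both[of i j] by (auto simp: win_matrix_def)
  have edge_sum: "(\<Sum>i\<in>?V. \<Sum>j\<in>?V. of_bool ((i, j) \<in> E) * h i j) = (\<Sum>e\<in>E. h (fst e) (snd e))" for h :: "nat \<Rightarrow> nat \<Rightarrow> real"
  proof -
    have "(\<Sum>i\<in>?V. \<Sum>j\<in>?V. of_bool ((i, j) \<in> E) * h i j) = (\<Sum>e\<in>?V \<times> ?V. of_bool (e \<in> E) * h (fst e) (snd e))"
      by (simp only: sum.cartesian_product case_prod_unfold prod.collapse)
    also have "\<dots> = (\<Sum>e\<in>E. h (fst e) (snd e))"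
      using EV by (intro sum.mono_neutral_cong_right) auto
    finally show ?thesis .
  qed
  have "log_likelihood (n + m) (win_matrix (E, W)) v = (\<Sum>i\<in>?V. \<Sum>j\<in>?V. win_matrix (E, W) i j * ?f i j)"
    unfolding log_likelihood_def
  proof (rule sum.cong[OF refl])
    fix i
    show "(\<Sum>j\<in>?V - {i}. win_matrix (E, W) i j * ?f i j) = (\<Sum>j\<in>?V. win_matrix (E, W) i j * ?f i j)"
      using no_both[of i i] by (intro sum.mono_neutral_left) (auto simp: win_matrix_def)
  qed
  also have "\<dots> = (\<Sum>i\<in>?V. \<Sum>j\<in>?V. of_bool ((i, j) \<in> E) * (of_bool (W (i, j)) * ?f i j))
      + (\<Sum>i\<in>?V. \<Sum>j\<in>?V. of_bool ((j, i) \<in> E) * (of_bool (\<not> W (j, i)) * ?f i j))"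
    unfolding split by (simp add: sum.distrib)
  also have "(\<Sum>i\<in>?V. \<Sum>j\<in>?V. of_bool ((j, i) \<in> E) * (of_bool (\<not> W (j, i)) * ?f i j))
      = (\<Sum>j\<in>?V. \<Sum>i\<in>?V. of_bool ((j, i) \<in> E) * (of_bool (\<not> W (j, i)) * ?f i j))"
    by (rule sum.swap)
  also have "(\<Sum>i\<in>?V. \<Sum>j\<in>?V. of_bool ((i, j) \<in> E) * (of_bool (W (i, j)) * ?f i j))
      + (\<Sum>j\<in>?V. \<Sum>i\<in>?V. of_bool ((j, i) \<in> E) * (of_bool (\<not> W (j, i)) * ?f i j))
      = (\<Sum>e\<in>E. of_bool (W e) * ?f (fst e) (snd e)) + (\<Sum>e\<in>E. of_bool (\<not> W e) * ?f (snd e) (fst e))"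
    using edge_sum[of "\<lambda>i j. of_bool (W (i, j)) * ?f i j"] edge_sum[of "\<lambda>j i. of_bool (\<not> W (j, i)) * ?f i j"]
    by simp
  also have "\<dots> = edge_loglik E W v"
    unfolding edge_loglik_def sum.distrib[symmetric]
  proof (rule sum.cong[OF refl])
    fix e :: "nat \<times> nat"
    let ?x = "v (fst e) - v (snd e)"
    have "1 + exp z > 0" for z :: real by (simp add: add_pos_pos)
    then have "ln (logistic z) = - ln (1 + exp (- z))" for z
      unfolding logistic_def by (simp add: ln_div)
    from this[of ?x] this[of "- ?x"] show "of_bool (W e) * ?f (fst e) (snd e) + of_bool (\<not> W e) * ?f (snd e) (fst e)
        = of_bool (W e) * ?x - ln (1 + exp ?x)"
      using ln_one_plus_exp_minus[of ?x] by (cases "W e") simp_all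
  qed
  finally show ?thesis .
qed

text \<open>The interior maximizer has error below \<open>r\<close>; shifting its first coordinate
  to 0 at most doubles this. Another maximizer differs from it by a vector that is constant on
  edges, hence constant, and the normalization fixes the constant.\<close>

lemma mle_close:
  assumes "btl_sample {1..n} {n+1..n+m} E d C u W \<kappa> \<alpha> r K" and u1: "u 1 = 0"
  shows "\<exists>v. is_mle (n + m) (win_matrix (E, W)) v \<and> (\<forall>w. is_mle (n + m) (win_matrix (E, W)) w \<longrightarrow> w = v)
           \<and> sup_dist (n + m) v u \<le> 2 * r"
proof -
  interpret btl_sample "{1..n}" "{n+1..n+m}" E d C u W \<kappa> \<alpha> r K by (rule assms)
  let ?V = "{1..n+m}"
  have V: "{1..n} \<union> {n+1..n+m} = ?V" by auto
  have one: "1 \<in> ?V" using card_L_pos by simp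
  obtain v0 where close: "\<And>i. i \<in> ?V \<Longrightarrow> \<bar>v0 i - u i\<bar> < r"
    and opt: "\<And>x. edge_loglik E W x \<le> edge_loglik E W v0"
    and uniq: "\<And>x e. edge_loglik E W x = edge_loglik E W v0 \<Longrightarrow> e \<in> E \<Longrightarrow>
        x (fst e) - v0 (fst e) = x (snd e) - v0 (snd e)"
    using maximizer_exists unfolding V by blast
  define v where "v = restrict (\<lambda>i. v0 i - v0 1) ?V"
  have EV: "E \<subseteq> ?V \<times> ?V" using edges_sub by auto
  have ll: "log_likelihood (n + m) (win_matrix (E, W)) x = edge_loglik E W x" for x
    using edges_sub by (rule log_likelihood_win_matrix)
  have v_v0: "edge_loglik E W v = edge_loglik E W v0"
    using EV by (intro edge_loglik_cong) (auto simp: v_def)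
  have mle: "is_mle (n + m) (win_matrix (E, W)) v"
    unfolding is_mle_def ll using opt v_v0 one by (simp add: normalized_vectors_def v_def)
  have unique: "w = v" if w: "is_mle (n + m) (win_matrix (E, W)) w" for w
  proof -
    have wn: "w \<in> extensional ?V" "w 1 = 0" using w by (simp_all add: is_mle_def normalized_vectors_def)
    have "edge_loglik E W v \<le> edge_loglik E W w" using w mle unfolding is_mle_def ll by blast
    then have eq: "edge_loglik E W w = edge_loglik E W v0" using opt[of w] v_v0 by linarith
    have const: "w i - v0 i = w 1 - v0 1" if "i \<in> ?V" for i
      using constant_on_edges_constant[OF depth, of "\<lambda>i. w i - v0 i" i 1] uniq[OF eq] that one
      unfolding V by blast
    show ?thesis
    proof (rule extensionalityI[OF wn(1)])
      show "v \<in> extensional ?V" by (simp add: v_def)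
      show "w i = v i" if "i \<in> ?V" for i using const[OF that] that wn(2) by (simp add: v_def)
    qed
  qed
  have "\<bar>v i - u i\<bar> \<le> 2 * r" if "i \<in> ?V" for i
    using close[OF that] close[OF one] that u1 by (simp add: v_def abs_le_iff abs_less_iff)
  then have "sup_dist (n + m) v u \<le> 2 * r"
    unfolding sup_dist_def using one by (subst Max_le_iff) auto
  then show ?thesis using mle unique by blast
qed

section \<open>From the smallness of \<open>Delta\<close> to the parameters of the expansion\<close>

lemma ln_le_scaled_root:
  fixes x k :: real
  assumes "x > 0" and "k > 0"
  shows "ln x \<le> k * x powr (1 / k)"
proof -
  have "ln (x powr (1 / k)) \<le> x powr (1 / k)" using ln_bound[of "x powr (1 / k)"] assms by simp
  then show ?thesis using assms by (simp add: ln_powr field_simps)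
qed

text \<open>The hypothesis amounts to \<open>l ^ 3 < c ^ 2 * (\<rho> * ln \<rho> ^ 2)\<close>. Below
  1 the factor \<open>\<rho> * ln \<rho> ^ 2\<close> is at most 4, which is too small for
  \<open>l \<ge> 4\<close>. Above 1, \<open>ln \<rho> ^ 2 \<le> 16 * sqrt \<rho>\<close> makes the
  right side a small multiple of \<open>sqrt \<rho> ^ 3\<close>.\<close>

lemma sparsity_consequences:
  fixes l \<rho> c :: real
  assumes l: "4 \<le> l" and \<rho>: "0 < \<rho>" and c: "0 < c" "c \<le> 1 / 2 ^ 11"
    and D: "sqrt (l ^ 3 / (\<rho> * ln \<rho> ^ 2)) < c" and ne: "\<rho> \<noteq> 1"
  shows "1 < \<rho>" and "64 * l < sqrt \<rho>"
proof -
  have ln2: "ln \<rho> ^ 2 > 0" using ne \<rho> by simp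
  have "l ^ 3 / (\<rho> * ln \<rho> ^ 2) < c ^ 2"
    using real_less_lsqrt D c real_sqrt_less_iff[of "l ^ 3 / (\<rho> * ln \<rho> ^ 2)" "c ^ 2"] by simp
  then have l3: "l ^ 3 < c ^ 2 * (\<rho> * ln \<rho> ^ 2)" using ln2 \<rho> by (simp add: divide_less_eq)
  have c2: "c ^ 2 \<le> 1 / 2 ^ 22" using c power_mono[of c "1 / 2 ^ 11" 2] by (simp add: power_divide)
  have root: "(x powr (1 / 2)) ^ 2 = x" "(x powr (1 / 4)) ^ 2 = x powr (1 / 2)" if "x > 0" for x :: real
    using that by (simp_all add: power2_eq_square powr_add[symmetric])
  show gt1: "1 < \<rho>"
  proof (rule ccontr)
    assume "\<not> 1 < \<rho>"
    then have lt: "\<rho> < 1" using ne by simp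
    have "- ln \<rho> \<le> 2 * (1 / \<rho>) powr (1 / 2)"
      using ln_le_scaled_root[of "1 / \<rho>" 2] \<rho> by (simp add: ln_div)
    then have "(- ln \<rho>) ^ 2 \<le> (2 * (1 / \<rho>) powr (1 / 2)) ^ 2"
      using lt \<rho> by (intro power_mono) auto
    also have "\<dots> = 4 / \<rho>" using root(1)[of "1 / \<rho>"] \<rho> by (simp add: power_mult_distrib)
    finally have "\<rho> * ln \<rho> ^ 2 \<le> 4" using \<rho> by (simp add: field_simps)
    then have "c ^ 2 * (\<rho> * ln \<rho> ^ 2) \<le> 1 / 2 ^ 22 * 4" using c2 \<rho> by (intro mult_mono) auto
    moreover have "4 ^ 3 \<le> l ^ 3" using l by (intro power_mono) auto
    ultimately show False using l3 by simp
  qed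
  have "ln \<rho> \<le> 4 * \<rho> powr (1 / 4)" using ln_le_scaled_root[of \<rho> 4] \<rho> by simp
  then have "ln \<rho> ^ 2 \<le> (4 * \<rho> powr (1 / 4)) ^ 2" using gt1 by (intro power_mono) auto
  also have "\<dots> = 16 * sqrt \<rho>" using root(2)[OF \<rho>] \<rho> by (simp add: power_mult_distrib powr_half_sqrt)
  finally have "\<rho> * ln \<rho> ^ 2 \<le> \<rho> * (16 * sqrt \<rho>)" using \<rho> by (intro mult_left_mono) auto
  also have "\<dots> = 16 * sqrt \<rho> ^ 3" using \<rho> by (simp add: power3_eq_cube)
  finally have "\<rho> * ln \<rho> ^ 2 \<le> 16 * sqrt \<rho> ^ 3" .
  with c2 have "c ^ 2 * (\<rho> * ln \<rho> ^ 2) \<le> 1 / 2 ^ 22 * (16 * sqrt \<rho> ^ 3)"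
    by (rule mult_mono) (use \<rho> in simp_all)
  \<comment> \<open>The constants are chosen for \<open>16 / 2 ^ 22 = (1 / 64) ^ 3\<close>.\<close>
  also have "\<dots> = (sqrt \<rho> / 64) ^ 3" by (simp add: power_divide)
  finally have "l ^ 3 < (sqrt \<rho> / 64) ^ 3" using l3 by linarith
  then have "l < sqrt \<rho> / 64" using \<rho> by (intro power_less_imp_less_base[of l 3]) auto
  then show "64 * l < sqrt \<rho>" by simp
qed

lemma depth_exists:
  fixes n m d :: nat
  defines "l \<equiv> ln (real (n + m))" and "\<rho> \<equiv> real n * d / m"
  assumes n: "1 \<le> n" and nm: "n \<le> m" and d: "1 \<le> d" "d \<le> m"
    and l: "4 \<le> l" and r: "0 < r" "r \<le> 1 / 2" and \<alpha>: "0 \<le> \<alpha>"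
    and small: "ereal (exp (2 * (\<alpha> + 1))) * Delta n m d < ereal (r / (72 * 2 ^ 15))"
  obtains K where "64 * l \<le> \<rho>" "2 ^ 16 \<le> \<rho>" "real n * d < (\<rho> / (16 * (2 * l))) ^ K"
    "sqrt (4 * l / \<rho>) * (4 * exp (\<alpha> + 1)) * 2 ^ 15 * (K + 3) \<le> r"
proof -
  define c where "c = r / (72 * 2 ^ 15)"
  define D where "D = sqrt (l ^ 3 / (\<rho> * ln \<rho> ^ 2))"
  have m: "m > 0" using n nm by simp
  have \<rho>: "\<rho> > 0" using n d m by (simp add: \<rho>_def)
  have \<rho>_alt: "real n / real m * real d = \<rho>" by (simp add: \<rho>_def)
  have c: "0 < c" "c \<le> 1 / 2 ^ 11" using r by (simp_all add: c_def)
  have ne: "\<rho> \<noteq> 1"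
  proof
    assume "\<rho> = 1"
    then show False using small unfolding Delta_def \<rho>_alt by simp
  qed
  have "real m * ln (real (n + m)) ^ 3 / (real n * real d * ln \<rho> ^ 2) = l ^ 3 / (\<rho> * ln \<rho> ^ 2)"
    using m n d by (simp add: \<rho>_def l_def)
  then have "Delta n m d = ereal D"
    using ne unfolding Delta_def \<rho>_alt D_def by simp
  then have eD2: "exp (2 * (\<alpha> + 1)) * D < c" using small by (simp add: c_def)
  have D0: "0 \<le> D" using l \<rho> by (simp add: D_def)
  have "exp (\<alpha> + 1) * D \<le> exp (2 * (\<alpha> + 1)) * D"
    using D0 \<alpha> by (intro mult_right_mono) auto
  then have eD: "exp (\<alpha> + 1) * D < c" using eD2 by linarith
  have "1 * D \<le> exp (\<alpha> + 1) * D" using D0 \<alpha> by (intro mult_right_mono) auto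
  then have "D < c" using eD by linarith
  note cons = sparsity_consequences[OF l \<rho> c this[unfolded D_def] ne]
  have sq: "\<rho> = sqrt \<rho> * sqrt \<rho>" using \<rho> by simp
  have "64 * l * (64 * l) \<le> sqrt \<rho> * sqrt \<rho>"
    using cons l by (intro mult_mono) auto
  then have big: "64 * l * (64 * l) \<le> \<rho>" using sq by simp
  have "64 * l * (64 * 4) \<le> 64 * l * (64 * l)" using l by (intro mult_left_mono) auto
  then have "64 * l * (64 * 4) \<le> \<rho>" using big by (rule order_trans)
  then have \<rho>1: "64 * l \<le> \<rho>" and \<rho>2: "2 ^ 16 \<le> \<rho>" using l by simp_all
  have lnpos: "0 < ln \<rho>" using cons(1) by simp
  have "\<rho> \<le> n + m"
  proof -
    have "\<rho> \<le> n" using d m by (simp add: \<rho>_def divide_le_eq mult_left_mono)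
    then show ?thesis by simp
  qed
  then have ln_le: "ln \<rho> \<le> l" unfolding l_def using \<rho> by (subst ln_le_cancel_iff) auto
  \<comment> \<open>The growth factor is at least \<open>sqrt \<rho>\<close>, so this many steps
    multiply by at least \<open>exp (2 * l)\<close>, the square of \<open>n + m\<close>, which
    exceeds \<open>n * d\<close>.\<close>
  define K where "K = nat \<lceil>4 * l / ln \<rho>\<rceil> + 1"
  have quot: "4 * l / ln \<rho> \<ge> 0" using l lnpos by simp
  then have K1: "4 * l / ln \<rho> \<le> K" and K2: "K + 3 \<le> 4 * l / ln \<rho> + 5"
    unfolding K_def by linarith+
  have growth: "real n * d < (\<rho> / (16 * (2 * l))) ^ K"
  proof -
    have "real n * d < real (n + m) * real (n + m)"
      using n d m nm by (intro mult_strict_mono) auto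
    also have "\<dots> = exp (2 * l)"
      using n exp_add[of l l] by (simp add: l_def)
    also have "\<dots> \<le> exp (K * (ln \<rho> / 2))"
      using K1 lnpos by (simp add: divide_le_eq mult_ac)
    also have "\<dots> = (exp (ln \<rho> / 2)) ^ K" by (rule exp_of_nat_mult)
    also have "exp (ln \<rho> / 2) = sqrt \<rho>"
      using exp_ln[of "sqrt \<rho>"] \<rho> by (simp add: ln_sqrt)
    also have "sqrt \<rho> ^ K \<le> (\<rho> / (16 * (2 * l))) ^ K"
    proof (rule power_mono)
      have "sqrt \<rho> * (16 * (2 * l)) \<le> sqrt \<rho> * sqrt \<rho>"
        using cons(2) l \<rho> by (intro mult_left_mono) auto
      then show "sqrt \<rho> \<le> \<rho> / (16 * (2 * l))"
        using l sq by (simp add: le_divide_eq)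
    qed (use \<rho> in simp)
    finally show ?thesis .
  qed
  \<comment> \<open>Since \<open>ln \<rho> \<le> l\<close>, the additive 5 is at most
    \<open>5 * (l / ln \<rho>)\<close>. The factor 9, the 4 from the slope bound and
    \<open>sqrt 4 = 2\<close> make up the 72 in the hypothesis.\<close>
  have "K + 3 \<le> 9 * (l / ln \<rho>)"
  proof -
    have "1 \<le> l / ln \<rho>" using ln_le lnpos by (simp add: le_divide_eq)
    then show ?thesis using K2 by linarith
  qed
  then have "sqrt (4 * l / \<rho>) * (4 * exp (\<alpha> + 1)) * 2 ^ 15 * (K + 3)
      \<le> sqrt (4 * l / \<rho>) * (4 * exp (\<alpha> + 1)) * 2 ^ 15 * (9 * (l / ln \<rho>))"
    using l \<rho> by (intro mult_left_mono) auto
  also have "\<dots> = 72 * 2 ^ 15 * (exp (\<alpha> + 1) * (sqrt (l / \<rho>) * (l / ln \<rho>)))"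
    by (simp add: real_sqrt_mult flip: times_divide_eq_right)
  also have "sqrt (l / \<rho>) * (l / ln \<rho>) = D"
  proof -
    have "D = sqrt (l / \<rho> * (l / ln \<rho>)\<^sup>2)"
      unfolding D_def by (rule arg_cong[of _ _ sqrt]) (simp add: power2_eq_square power3_eq_cube)
    also have "\<dots> = sqrt (l / \<rho>) * (l / ln \<rho>)"
      using l lnpos by (simp only: real_sqrt_mult real_sqrt_abs) simp
    finally show ?thesis by simp
  qed
  also have "72 * 2 ^ 15 * (exp (\<alpha> + 1) * D) \<le> 72 * 2 ^ 15 * c"
    using eD by simp
  also have "\<dots> = r" by (simp add: c_def)
  finally show thesis using that[OF \<rho>1 \<rho>2 growth] by simp
qed

lemma merit_range_ge:
  assumes "i \<in> {1..N}" "j \<in> {1..N}"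
  shows "u i - u j \<le> merit_range N u"
  unfolding merit_range_def using assms by (intro Max_ge) force+

lemma prob_mle_close_ge:
  fixes n m d :: nat and u :: "nat \<Rightarrow> real"
  assumes n: "81 \<le> n" and nm: "n \<le> m" and d: "1 \<le> d" "d \<le> m" and u1: "u 1 = 0" and \<epsilon>: "0 < \<epsilon>"
    and small: "ereal (exp (2 * (merit_range (n + m) u + 1))) * Delta n m d
        < ereal (min (\<epsilon> / 2) (1 / 2) / (72 * 2 ^ 15))"
  shows "1 - 8 / real (n + m) \<le> measure_pmf.prob (btl_model n m d u)
            {\<omega>. \<exists>v. is_mle (n + m) (win_matrix \<omega>) v
                  \<and> (\<forall>w. is_mle (n + m) (win_matrix \<omega>) w \<longrightarrow> w = v)
                  \<and> sup_dist (n + m) v u \<le> \<epsilon>}" (is "_ \<le> measure_pmf.prob ?P ?good")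
proof -
  define l \<rho> r \<alpha> where "l = ln (real (n + m))" and "\<rho> = real n * d / m"
    and "r = min (\<epsilon> / 2) (1 / 2)" and "\<alpha> = merit_range (n + m) u"
  \<comment> \<open>The threshold 81 is \<open>3 ^ 4\<close>, which dominates \<open>exp 4\<close>
    and gives \<open>l \<ge> 4\<close>.\<close>
  have "exp 4 \<le> real (n + m)"
  proof -
    have "exp (4::real) = exp 1 ^ 4" using exp_of_nat_mult[of 4 "1::real"] by simp
    also have "\<dots> \<le> 3 ^ 4" using exp_le by (intro power_mono) auto
    finally show ?thesis using n by simp
  qed
  then have l: "4 \<le> l" unfolding l_def using n by (subst ln_ge_iff) auto
  have r: "0 < r" "r \<le> 1 / 2" "2 * r \<le> \<epsilon>" using \<epsilon> by (auto simp: r_def)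
  have \<alpha>: "0 \<le> \<alpha>" using merit_range_ge[of 1 "n + m" 1 u] n by (simp add: \<alpha>_def)
  obtain K where K: "64 * l \<le> \<rho>" "2 ^ 16 \<le> \<rho>" "real n * d < (\<rho> / (16 * (2 * l))) ^ K"
    "sqrt (4 * l / \<rho>) * (4 * exp (\<alpha> + 1)) * 2 ^ 15 * (K + 3) \<le> r"
    using depth_exists[of n m d r \<alpha>] n nm d l r \<alpha> small unfolding l_def \<rho>_def r_def \<alpha>_def by auto
  let ?bad = "{(E, W). \<not> (bipartite_expander {1..n} {n+1..n+m} E d (2 * l) \<and>
      small_noise {1..n} {n+1..n+m} (sqrt (4 * l / \<rho>)) u E W)}"
  have "\<omega> \<in> ?good" if "\<omega> \<notin> ?bad" for \<omega>
  proof -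
    obtain E W where \<omega>: "\<omega> = (E, W)" by (cases \<omega>)
    have ex: "bipartite_expander {1..n} {n+1..n+m} E d (2 * l)"
      and noise: "small_noise {1..n} {n+1..n+m} (sqrt (4 * l / \<rho>)) u E W"
      using that \<omega> by auto
    have "btl_sample {1..n} {n+1..n+m} E d (2 * l) u W (sqrt (4 * l / \<rho>)) \<alpha> r K"
    proof (intro btl_sample.intro btl_sample_axioms.intro ex noise)
      show "u i - u j \<le> \<alpha>" if "i \<in> {1..n} \<union> {n+1..n+m}" "j \<in> {1..n} \<union> {n+1..n+m}" for i j
        unfolding \<alpha>_def using that by (intro merit_range_ge) auto
      show "bipartite_expander.expansion_depth {1..n} {n+1..n+m} d (2 * l) K"
        unfolding bipartite_expander.expansion_depth_def[OF ex] bipartite_expander.mean_degree_def[OF ex]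
        using K(3) by (simp add: \<rho>_def)
    qed (use r K(4) in auto)
    then have "\<exists>v. is_mle (n + m) (win_matrix \<omega>) v \<and> (\<forall>w. is_mle (n + m) (win_matrix \<omega>) w \<longrightarrow> w = v)
           \<and> sup_dist (n + m) v u \<le> 2 * r"
      unfolding \<omega> using u1 by (rule mle_close)
    then show ?thesis using r(3) by (auto intro: order_trans)
  qed
  then have "- ?bad \<subseteq> ?good" by blast
  then have "measure_pmf.prob ?P (- ?bad) \<le> measure_pmf.prob ?P ?good"
    by (intro measure_pmf.finite_measure_mono) auto
  moreover have "measure_pmf.prob ?P (- ?bad) = 1 - measure_pmf.prob ?P ?bad"
    using measure_pmf.prob_compl[of ?bad ?P] by (simp add: Compl_eq_Diff_UNIV)
  moreover have "measure_pmf.prob ?P ?bad \<le> 8 / (n + m)"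
    unfolding l_def \<rho>_def using n nm d K(1,2) by (intro prob_btl_model_bad_le) (auto simp: l_def \<rho>_def)
  ultimately show ?thesis by linarith
qed

theorem theorem12:
  fixes n m :: "nat \<Rightarrow> nat"
    and d :: "nat \<Rightarrow> nat \<Rightarrow> nat"
    and u :: "nat \<Rightarrow> nat \<Rightarrow> nat \<Rightarrow> real"
  assumes n_infinity: "filterlim n at_top sequentially"
    and m_infinity: "filterlim m at_top sequentially"
    and n_le_m: "\<And>k. n k \<le> m k"
    and d_bounds: "\<And>k. 1 \<le> d (n k) (m k) \<and> d (n k) (m k) \<le> m k"
    and u_normalized: "\<And>k. u (n k) (m k) 1 = 0"
    and Delta_small:
      "(\<lambda>k. ereal (exp (2 * (merit_range (n k + m k) (u (n k) (m k)) + 1)))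
              * Delta (n k) (m k) (d (n k) (m k))) \<longlonglongrightarrow> 0"
  shows "\<forall>\<epsilon>>0. (\<lambda>k. measure_pmf.prob (btl_model (n k) (m k) (d (n k) (m k)) (u (n k) (m k)))
            {\<omega>. \<exists>v. is_mle (n k + m k) (win_matrix \<omega>) v
                  \<and> (\<forall>w. is_mle (n k + m k) (win_matrix \<omega>) w \<longrightarrow> w = v)
                  \<and> sup_dist (n k + m k) v (u (n k) (m k)) \<le> \<epsilon>}) \<longlonglongrightarrow> 1"
proof (intro allI impI)
  fix \<epsilon> :: real assume \<epsilon>: "\<epsilon> > 0"
  let ?p = "\<lambda>k. measure_pmf.prob (btl_model (n k) (m k) (d (n k) (m k)) (u (n k) (m k)))
            {\<omega>. \<exists>v. is_mle (n k + m k) (win_matrix \<omega>) v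
                  \<and> (\<forall>w. is_mle (n k + m k) (win_matrix \<omega>) w \<longrightarrow> w = v)
                  \<and> sup_dist (n k + m k) v (u (n k) (m k)) \<le> \<epsilon>}"
  \<comment> \<open>The threshold of \<open>prob_mle_close_ge\<close> depends on
    \<open>\<epsilon>\<close> only, so the product eventually falls below it.\<close>
  have "(0::ereal) < ereal (min (\<epsilon> / 2) (1 / 2) / (72 * 2 ^ 15))" using \<epsilon> by simp
  from order_tendstoD(2)[OF Delta_small this]
  have lower: "\<forall>\<^sub>F k in sequentially. 1 - 8 / real (n k + m k) \<le> ?p k"
    using filterlim_at_top[THEN iffD1, OF n_infinity, rule_format, of 81]
  proof eventually_elim
    case (elim k)
    show ?case
      using d_bounds[of k]
      by (intro prob_mle_close_ge[OF elim(2) n_le_m _ _ u_normalized \<epsilon> elim(1)]) simp_all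
  qed
  have upper: "\<forall>\<^sub>F k in sequentially. ?p k \<le> 1" by (intro always_eventually allI measure_pmf.prob_le_1)
  have lim: "(\<lambda>k. 1 - 8 / real (n k + m k)) \<longlonglongrightarrow> 1"
  proof -
    have "filterlim (\<lambda>k. n k + m k) at_top sequentially"
      by (rule filterlim_at_top_mono[OF n_infinity]) simp
    then have "filterlim (\<lambda>k. real (n k + m k)) at_top sequentially"
      by (rule filterlim_compose[OF filterlim_real_sequentially])
    then have "(\<lambda>k. 8 / real (n k + m k)) \<longlonglongrightarrow> 0"
      by (intro tendsto_divide_0[OF tendsto_const] filterlim_at_top_imp_at_infinity)
    then show ?thesis using tendsto_diff[OF tendsto_const[of "1::real"]] by fastforce
  qed
  show "?p \<longlonglongrightarrow> 1" by (rule tendsto_sandwich[OF lower upper lim tendsto_const])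
qed

end
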